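(* There is no infinite sequence $(\gamma_n)$ of embeddings $\gamma_n:\mathbb T^1\to\mathbb R^3$, belonging to pairwise distinct ambient isotopy classes of knots, for which both the distortions $\delta_\infty(\gamma_n)$ and the bending energies $E_{\mathrm b}(\gamma_n)$ are uniformly bounded.
   Context: $\mathbb T^1$ is the circle $[-\pi,\pi]$ with endpoints identified. The distortion $\delta_\infty(\gamma)$ is the supremum over distinct points of the curve of the ratio of arc-length distance along the curve to Euclidean distance. The scale-invariant bending energy is $E_{\mathrm b}(\gamma)=\frac{\mathrm{len}(\gamma)}{2\pi}\cdot\frac1{2\pi}\int_{\mathbb T^1}\kappa_\gamma^2(x)|\gamma'(x)|\,dx$, with $\kappa_\gamma$ the pointwise curvature and $\mathrm{len}(\gamma)$ the length. Curves are parametrized with constant speed and lie in $H^2(\mathbb T^1;\mathbb R^3)$ when the bending energy is finite. *)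

theory Defs
  imports "HOL-Analysis.Analysis"
begin

text \<open>Functions on the circle \<open>[-\<pi>, \<pi>]\<close> with endpoints identified are represented by
  \<open>2\<pi>\<close>-periodic functions on the real line, integrals over the circle by integrals over
  \<open>[-\<pi>, \<pi>]\<close> with respect to Lebesgue measure.\<close>

definition circle_periodic :: "(real \<Rightarrow> 'a) \<Rightarrow> bool" where
  "circle_periodic f \<longleftrightarrow> (\<forall>t. f (t + 2 * pi) = f t)"

abbreviation circle_measure :: "real measure" where
  "circle_measure \<equiv> lebesgue_on {-pi..pi}"


section \<open>Sobolev regularity on the circle\<close>

definition circle_test_function :: "(real \<Rightarrow> real) \<Rightarrow> bool" where
  "circle_test_function \<phi> \<longleftrightarrow>
     circle_periodic \<phi> \<and> (\<forall>k t. (deriv ^^ k) \<phi> differentiable (at t))"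

definition circle_L2 :: "(real \<Rightarrow> 'a::euclidean_space) \<Rightarrow> bool" where
  "circle_L2 f \<longleftrightarrow> f \<in> borel_measurable circle_measure \<and>
     integrable circle_measure (\<lambda>t. (norm (f t))\<^sup>2)"

definition has_circle_weak_deriv ::
    "(real \<Rightarrow> 'a::euclidean_space) \<Rightarrow> (real \<Rightarrow> 'a) \<Rightarrow> bool" where
  "has_circle_weak_deriv f g \<longleftrightarrow> circle_L2 f \<and> circle_L2 g \<and>
     (\<forall>\<phi>. circle_test_function \<phi> \<longrightarrow>
        (\<integral>t. deriv \<phi> t *\<^sub>R f t \<partial>circle_measure) = - (\<integral>t. \<phi> t *\<^sub>R g t \<partial>circle_measure))"

text \<open>The weak derivative is unique almost everywhere on \<open>[-\<pi>, \<pi>]\<close>, so the choice of a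
  representative does not affect integrals.\<close>

definition circle_weak_deriv :: "(real \<Rightarrow> 'a::euclidean_space) \<Rightarrow> real \<Rightarrow> 'a" where
  "circle_weak_deriv f = (SOME g. has_circle_weak_deriv f g)"

definition circle_H2 :: "(real \<Rightarrow> 'a::euclidean_space) \<Rightarrow> bool" where
  "circle_H2 f \<longleftrightarrow> (\<exists>g h. has_circle_weak_deriv f g \<and> has_circle_weak_deriv g h)"


section \<open>Embedded closed curves\<close>

text \<open>As the circle is compact, a continuous injection is a homeomorphism onto its image.\<close>

definition circle_embedding :: "(real \<Rightarrow> real^3) \<Rightarrow> bool" where
  "circle_embedding \<gamma> \<longleftrightarrow>
     circle_periodic \<gamma> \<and> continuous_on UNIV \<gamma> \<and> inj_on \<gamma> {-pi..<pi}"

definition velocity :: "(real \<Rightarrow> real^3) \<Rightarrow> real \<Rightarrow> real^3" where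
  "velocity \<gamma> t = vector_derivative \<gamma> (at t)"

text \<open>A constant speed parametrization is Lipschitz, hence differentiable almost everywhere, and
  the length of each of its arcs is the integral of the speed.\<close>

definition constant_speed :: "(real \<Rightarrow> real^3) \<Rightarrow> bool" where
  "constant_speed \<gamma> \<longleftrightarrow> (\<exists>L. L-lipschitz_on UNIV \<gamma>) \<and>
     (\<exists>c. AE t in lebesgue. \<gamma> differentiable (at t) \<and> norm (velocity \<gamma> t) = c)"

definition arc_length :: "(real \<Rightarrow> real^3) \<Rightarrow> real \<Rightarrow> real \<Rightarrow> real" where
  "arc_length \<gamma> s t = (\<integral>x. norm (velocity \<gamma> x) \<partial>lebesgue_on {s..t})"

definition curve_len :: "(real \<Rightarrow> real^3) \<Rightarrow> real" where
  "curve_len \<gamma> = arc_length \<gamma> (-pi) pi"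

text \<open>For \<open>-\<pi> \<le> s \<le> t < \<pi>\<close>: the length of the shorter of the two arcs joining the points
  with parameters \<open>s\<close> and \<open>t\<close>.\<close>

definition curve_dist :: "(real \<Rightarrow> real^3) \<Rightarrow> real \<Rightarrow> real \<Rightarrow> real" where
  "curve_dist \<gamma> s t = min (arc_length \<gamma> s t) (curve_len \<gamma> - arc_length \<gamma> s t)"

definition distortion :: "(real \<Rightarrow> real^3) \<Rightarrow> ennreal" where
  "distortion \<gamma> =
     (SUP (s, t) \<in> {(s, t). -pi \<le> s \<and> s < t \<and> t < pi}.
        ennreal (curve_dist \<gamma> s t / dist (\<gamma> s) (\<gamma> t)))"

text \<open>The formula \<open>|\<gamma>' \<times> \<gamma>''| / |\<gamma>'|\<^sup>3\<close>, with \<open>\<gamma>''\<close> the weak derivative of \<open>\<gamma>'\<close>.\<close>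

definition curvature :: "(real \<Rightarrow> real^3) \<Rightarrow> real \<Rightarrow> real" where
  "curvature \<gamma> t =
     norm (cross3 (velocity \<gamma> t) (circle_weak_deriv (velocity \<gamma>) t)) / norm (velocity \<gamma> t) ^ 3"

text \<open>Curves that are not in \<open>H\<^sup>2\<close> have infinite bending energy.\<close>

definition bending_energy :: "(real \<Rightarrow> real^3) \<Rightarrow> ennreal" where
  "bending_energy \<gamma> =
     (if circle_H2 \<gamma> then
        ennreal (curve_len \<gamma> / (2 * pi)) * (ennreal (1 / (2 * pi)) *
          (\<integral>\<^sup>+t. ennreal ((curvature \<gamma> t)\<^sup>2 * norm (velocity \<gamma> t)) \<partial>circle_measure))
      else \<infinity>)"


section \<open>Ambient isotopy\<close>

definition ambient_isotopic :: "(real^3) set \<Rightarrow> (real^3) set \<Rightarrow> bool" where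
  "ambient_isotopic K K' \<longleftrightarrow>
     (\<exists>\<Phi>. homotopic_with_canon (\<lambda>\<Psi>. \<exists>\<Psi>'. homeomorphism UNIV UNIV \<Psi> \<Psi>') UNIV UNIV id \<Phi> \<and>
          \<Phi> ` K = K')"

end

theory Submission
  imports Defs "HOL-Complex_Analysis.Great_Picard"
begin

text \<open>
  Along a sequence of curves with bounded distortion and bending energy, two curves have unit
  tangents so close that an explicit ambient isotopy carries one curve to the other.

  \<^bold>\<open>Compactness.\<close> For a curve of constant speed \<open>c\<close> the bending energy is the mean over the circle of
  \<open>norm T' ^ 2\<close>, where \<open>T\<close> is the unit tangent. A bound on it therefore gives a modulus of continuity
  of \<open>T\<close> that does not depend on the curve or on its length (\<open>tangent_modulus\<close>,
  \<open>bounded_bending_energy\<close>). By the theorem of Arzela and Ascoli, for each \<open>\<epsilon> > 0\<close> two curves \<open>\<gamma>\<close> and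
  \<open>\<eta>\<close> of the sequence have unit tangents at uniform distance at most \<open>\<epsilon>\<close>.

  \<^bold>\<open>Isotopy.\<close> Rescale \<open>\<eta>\<close> to the speed of \<open>\<gamma>\<close>. The displacement from \<open>\<gamma>\<close> to \<open>\<eta>\<close> then has Lipschitz constant
  \<open>\<epsilon>\<close> with respect to arc length along \<open>\<gamma>\<close> (\<open>close_tangents_imp_close_curves\<close>). If \<open>D\<close> bounds the
  distortion, arc length is at most \<open>D\<close> times Euclidean distance, so the displacement is an
  \<open>\<epsilon> * D\<close>-Lipschitz map on the point set of \<open>\<gamma>\<close>. It extends to a Lipschitz map \<open>F\<close> of the whole space,
  still with constant below 1 when \<open>\<epsilon>\<close> is small, and \<open>x \<mapsto> x + t * F x\<close> is a homeomorphism for each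
  \<open>t\<close> in the unit interval (\<open>ambient_isotopic_relatively_close\<close>).

  \<^bold>\<open>Regularity.\<close> The curves are given with weak derivatives. The lemma of du Bois-Reymond
  (\<open>du_Bois_Reymond\<close>), proved with trigonometric polynomials as test functions, turns these into
  indefinite integrals, for which integration by parts holds (\<open>integral_by_parts_indefinite\<close>).
\<close>

section \<open>Ambient isotopies from Lipschitz perturbations\<close>

text \<open>The formula of McShane: the infimum of the cones of slope \<open>L\<close> standing on the graph of \<open>f\<close>
  is the largest \<open>L\<close>-Lipschitz function that stays below \<open>f\<close> on \<open>S\<close>.\<close>

lemma lipschitz_extension_real:
  fixes f :: "'a::metric_space \<Rightarrow> real"
  assumes f: "L-lipschitz_on S f"
  obtains g where "L-lipschitz_on UNIV g" "\<And>x. x \<in> S \<Longrightarrow> g x = f x"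
proof (cases "S = {}")
  case True
  have "L-lipschitz_on UNIV (\<lambda>x::'a. 0::real)"
    using lipschitz_on_nonneg[OF f] by (auto intro!: lipschitz_onI)
  then show ?thesis using that True by blast
next
  case False
  have L: "0 \<le> L" using lipschitz_on_nonneg[OF f] .
  define g where "g x = (INF y\<in>S. f y + L * dist x y)" for x
  have lower: "f z - L * dist x z \<le> f y + L * dist x y" if "y \<in> S" "z \<in> S" for x y z
  proof -
    have "f z - f y \<le> L * dist z y"
      using lipschitz_onD[OF f that(2,1)] by (simp add: dist_real_def)
    also have "\<dots> \<le> L * (dist x z + dist x y)"
      using L dist_triangle3[of z y x] by (simp add: mult_left_mono)
    finally show ?thesis by (simp add: algebra_simps)
  qed
  have bdd: "bdd_below ((\<lambda>y. f y + L * dist x y) ` S)" for x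
    using False lower by (fast intro: bdd_belowI2)
  have g_le: "g x \<le> g x' + L * dist x x'" for x x'
  proof -
    have "g x - L * dist x x' \<le> f y + L * dist x' y" if "y \<in> S" for y
    proof -
      have "g x \<le> f y + L * dist x y"
        unfolding g_def by (rule cINF_lower[OF bdd that])
      also have "L * dist x y \<le> L * (dist x x' + dist x' y)"
        using L by (intro mult_left_mono dist_triangle)
      finally show ?thesis by (simp add: algebra_simps)
    qed
    then have "g x - L * dist x x' \<le> g x'"
      unfolding g_def[of x'] using False by (intro cINF_greatest)
    then show ?thesis by simp
  qed
  show ?thesis
  proof
    show "L-lipschitz_on UNIV g"
    proof (rule lipschitz_onI)
      show "dist (g x) (g y) \<le> L * dist x y" for x y
        using g_le[of x y] g_le[of y x] by (simp add: dist_real_def dist_commute)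
    qed (rule L)
    show "g x = f x" if "x \<in> S" for x
    proof (rule antisym)
      show "g x \<le> f x"
        using cINF_lower[OF bdd[of x] that] by (simp add: g_def)
      show "f x \<le> g x"
        unfolding g_def using False lower[OF _ that, of _ x] by (intro cINF_greatest) auto
    qed
  qed
qed

text \<open>Extending each coordinate separately multiplies the Lipschitz constant by at most the dimension.\<close>

lemma lipschitz_extension:
  fixes f :: "'a::metric_space \<Rightarrow> 'b::euclidean_space"
  assumes f: "L-lipschitz_on S f"
  obtains g where "(real DIM('b) * L)-lipschitz_on UNIV g" "\<And>x. x \<in> S \<Longrightarrow> g x = f x"
proof -
  have "\<exists>h. L-lipschitz_on UNIV h \<and> (\<forall>x\<in>S. h x = f x \<bullet> b)" if b: "b \<in> Basis" for b
  proof -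
    have "L-lipschitz_on S (\<lambda>x. f x \<bullet> b)"
    proof (rule lipschitz_onI)
      fix x y assume "x \<in> S" "y \<in> S"
      have "dist (f x \<bullet> b) (f y \<bullet> b) = \<bar>(f x - f y) \<bullet> b\<bar>"
        by (simp add: dist_real_def inner_diff_left)
      also have "\<dots> \<le> dist (f x) (f y)"
        using Basis_le_norm[OF b] by (simp add: dist_norm)
      also have "\<dots> \<le> L * dist x y" by (rule lipschitz_onD[OF f \<open>x \<in> S\<close> \<open>y \<in> S\<close>])
      finally show "dist (f x \<bullet> b) (f y \<bullet> b) \<le> L * dist x y" .
    qed (rule lipschitz_on_nonneg[OF f])
    then obtain h where "L-lipschitz_on UNIV h" "\<And>x. x \<in> S \<Longrightarrow> h x = f x \<bullet> b"
      by (rule lipschitz_extension_real) blast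
    then show ?thesis by blast
  qed
  then obtain h where h: "\<And>b. b \<in> Basis \<Longrightarrow> L-lipschitz_on UNIV (h b)"
    "\<And>b x. b \<in> Basis \<Longrightarrow> x \<in> S \<Longrightarrow> h b x = f x \<bullet> b" by metis
  define g where "g x = (\<Sum>b\<in>Basis. h b x *\<^sub>R b)" for x
  show ?thesis
  proof
    show "(real DIM('b) * L)-lipschitz_on UNIV g"
    proof (rule lipschitz_onI)
      fix x y
      have "dist (g x) (g y) = norm (\<Sum>b\<in>Basis. (h b x - h b y) *\<^sub>R b)"
        by (simp add: g_def dist_norm sum_subtractf scaleR_diff_left)
      also have "\<dots> \<le> (\<Sum>b\<in>Basis. dist (h b x) (h b y))"
        by (rule order.trans[OF norm_sum]) (simp add: dist_real_def)
      also have "\<dots> \<le> (\<Sum>b\<in>(Basis :: 'b set). L * dist x y)"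
        by (intro sum_mono lipschitz_onD[OF h(1)]) auto
      finally show "dist (g x) (g y) \<le> real DIM('b) * L * dist x y" by simp
    qed (simp add: lipschitz_on_nonneg[OF f])
    show "g x = f x" if "x \<in> S" for x
      using that by (simp add: g_def h(2) euclidean_representation)
  qed
qed

text \<open>Solving \<open>x + F x = y\<close> means finding a fixed point of the contraction \<open>x \<mapsto> y - F x\<close>; as
  \<open>id + F\<close> multiplies distances by at least \<open>1 - L\<close>, the inverse is Lipschitz.\<close>

lemma lipschitz_perturbation_homeomorphism:
  fixes F :: "'a::{complete_space,real_normed_vector} \<Rightarrow> 'a"
  assumes F: "L-lipschitz_on UNIV F" and L: "L < 1"
  obtains H where "homeomorphism UNIV UNIV (\<lambda>x. x + F x) H"
proof -
  have L0: "0 \<le> L" by (rule lipschitz_on_nonneg[OF F])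
  have expand: "(1 - L) * dist x y \<le> dist (x + F x) (y + F y)" for x y
  proof -
    have "norm (x - y) \<le> norm ((x + F x) - (y + F y)) + norm (F x - F y)"
      using norm_triangle_ineq4[of "(x + F x) - (y + F y)" "F x - F y"] by (simp add: algebra_simps)
    moreover have "norm (F x - F y) \<le> L * norm (x - y)"
      using lipschitz_on_normD[OF F] by simp
    ultimately show ?thesis by (simp add: dist_norm algebra_simps)
  qed
  have inj: "inj (\<lambda>x. x + F x)"
    using expand L by (intro injI) (metis diff_gt_0_iff_gt dist_eq_0_iff mult_le_0_iff not_le zero_less_dist_iff)
  have surj: "surj (\<lambda>x. x + F x)"
  proof (rule surjI)
    fix y
    have "\<exists>!x. y - F x = x"
      using lipschitz_onD[OF F] by (intro banach_fix_type[OF L0 L]) (simp add: dist_norm norm_minus_commute)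
    then show "(THE x. y - F x = x) + F (THE x. y - F x = x) = y"
      by (metis (mono_tags, lifting) diff_add_cancel theI')
  qed
  let ?H = "inv (\<lambda>x. x + F x)"
  have H: "?H y + F (?H y) = y" for y using surj_f_inv_f[OF surj] by simp
  have H': "?H (x + F x) = x" for x using inv_f_f[OF inj, of x] by simp
  have "(1 / (1 - L))-lipschitz_on UNIV ?H"
  proof (rule lipschitz_onI)
    show "dist (?H y) (?H z) \<le> 1 / (1 - L) * dist y z" for y z
      using expand[of "?H y" "?H z"] L by (simp add: H field_simps)
  qed (use L in simp)
  then have "continuous_on UNIV ?H" by (rule lipschitz_on_continuous_on)
  moreover have "continuous_on UNIV (\<lambda>x. x + F x)"
    by (intro continuous_intros lipschitz_on_continuous_on[OF F])
  ultimately have "homeomorphism UNIV UNIV (\<lambda>x. x + F x) ?H"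
    using surj H H' by (auto simp: homeomorphism_def inj_imp_surj_inv[OF inj])
  then show ?thesis by (rule that)
qed

text \<open>The isotopy switches on \<open>F\<close> and the dilation by \<open>a\<close> linearly in time. Since \<open>F\<close> may be
  unbounded, it absorbs translations; the dilation takes care of curves of different lengths.\<close>

lemma ambient_isotopic_lipschitz_perturbation:
  fixes K :: "(real^3) set"
  assumes F: "L-lipschitz_on UNIV F" and L: "L < 1" and a: "0 < a"
  shows "ambient_isotopic K ((\<lambda>x. a *\<^sub>R (x + F x)) ` K)"
proof -
  define h where "h = (\<lambda>(t::real, x). (1 - t + t * a) *\<^sub>R (x + t *\<^sub>R F x))"
  have homeo: "\<exists>H. homeomorphism UNIV UNIV (\<lambda>x. h (t, x)) H" if t: "t \<in> {0..1}" for t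
  proof -
    have "(t * L)-lipschitz_on UNIV (\<lambda>x. t *\<^sub>R F x)"
    proof (rule lipschitz_onI)
      show "dist (t *\<^sub>R F x) (t *\<^sub>R F y) \<le> t * L * dist x y" for x y
        using t lipschitz_onD[OF F, of x y] mult_left_mono[of "dist (F x) (F y)" "L * dist x y" t]
        by (simp add: dist_norm mult.assoc flip: scaleR_diff_right)
    qed (use t lipschitz_on_nonneg[OF F] in simp)
    moreover have "t * L < 1"
      using t L lipschitz_on_nonneg[OF F] by (smt (verit) atLeastAtMost_iff mult_left_le_one_le)
    ultimately obtain H where H: "homeomorphism UNIV UNIV (\<lambda>x. x + t *\<^sub>R F x) H"
      by (rule lipschitz_perturbation_homeomorphism)
    have pos: "1 - t + t * a \<noteq> 0"
      using t a by (smt (verit) atLeastAtMost_iff mult_nonneg_nonneg mult_pos_pos)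
    have "homeomorphism UNIV UNIV (\<lambda>x::real^3. (1 - t + t * a) *\<^sub>R x) (\<lambda>x. (1 / (1 - t + t * a)) *\<^sub>R x)"
      using pos by (auto simp: homeomorphism_def surj_def intro!: continuous_intros)
        (rule_tac x="(1 / (1 - t + t * a)) *\<^sub>R y" in exI, simp, rule_tac x="(1 - t + t * a) *\<^sub>R y" in exI, simp)
    from homeomorphism_compose[OF H this] show ?thesis
      by (auto simp: h_def o_def)
  qed
  have "continuous_on ({0..1} \<times> UNIV) h"
    unfolding h_def split_def
    by (intro continuous_intros continuous_on_compose2[OF lipschitz_on_continuous_on[OF F]]) auto
  then have "continuous_map (prod_topology (top_of_set {0..1}) (top_of_set UNIV)) (top_of_set UNIV) h"
    unfolding prod_topology_subtopology_eu by (simp add: continuous_map_in_subtopology)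
  then have "homotopic_with_canon (\<lambda>\<Psi>. \<exists>\<Psi>'. homeomorphism UNIV UNIV \<Psi> \<Psi>') UNIV UNIV id (\<lambda>x. a *\<^sub>R (x + F x))"
    unfolding homotopic_with_def
    by (intro exI[of _ h] conjI ballI homeo) (auto simp: h_def)
  then show ?thesis unfolding ambient_isotopic_def by blast
qed

text \<open>The displacement \<open>\<gamma> s \<mapsto> \<eta> s / a - \<gamma> s\<close> is a Lipschitz map on the point set of \<open>\<gamma>\<close>, not only in
  the parameter. It therefore extends to all of space, with its constant multiplied by the
  dimension 3; this is where \<open>3 * e < 1\<close> comes from.\<close>

lemma ambient_isotopic_relatively_close:
  fixes \<gamma> \<eta> :: "'i \<Rightarrow> real^3"
  assumes close: "\<And>s t. s \<in> I \<Longrightarrow> t \<in> I \<Longrightarrow>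
      norm ((\<eta> s /\<^sub>R a - \<gamma> s) - (\<eta> t /\<^sub>R a - \<gamma> t)) \<le> e * norm (\<gamma> s - \<gamma> t)"
    and e: "0 \<le> e" "3 * e < 1" and a: "0 < a"
  shows "ambient_isotopic (\<gamma> ` I) (\<eta> ` I)"
proof -
  have wd: "\<gamma> s = \<gamma> t \<Longrightarrow> \<eta> s = \<eta> t" if "s \<in> I" "t \<in> I" for s t
    using close[OF that] a by auto
  define f where "f x = (let s = SOME s. s \<in> I \<and> \<gamma> s = x in \<eta> s /\<^sub>R a - \<gamma> s)" for x
  have f: "f (\<gamma> s) = \<eta> s /\<^sub>R a - \<gamma> s" if "s \<in> I" for s
  proof -
    have "(SOME s'. s' \<in> I \<and> \<gamma> s' = \<gamma> s) \<in> I \<and> \<gamma> (SOME s'. s' \<in> I \<and> \<gamma> s' = \<gamma> s) = \<gamma> s"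
      using that by (intro someI[of "\<lambda>s'. s' \<in> I \<and> \<gamma> s' = \<gamma> s" s]) simp
    then show ?thesis using wd[OF _ that] by (simp add: f_def Let_def)
  qed
  have "e-lipschitz_on (\<gamma> ` I) f"
    using close e by (auto intro!: lipschitz_onI simp: f dist_norm)
  then obtain F where F: "(real DIM(real^3) * e)-lipschitz_on UNIV F" "\<And>x. x \<in> \<gamma> ` I \<Longrightarrow> F x = f x"
    by (rule lipschitz_extension) blast
  have "ambient_isotopic (\<gamma> ` I) ((\<lambda>x. a *\<^sub>R (x + F x)) ` \<gamma> ` I)"
    by (rule ambient_isotopic_lipschitz_perturbation[OF F(1)]) (use e a in auto)
  also have "(\<lambda>x. a *\<^sub>R (x + F x)) ` \<gamma> ` I = \<eta> ` I"
    using a by (auto simp: F(2) f image_image)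
  finally show ?thesis .
qed

section \<open>Integration by parts for indefinite integrals\<close>

lemma absolutely_integrable_iff_lebesgue_on:
  fixes f :: "'a::euclidean_space \<Rightarrow> 'b::euclidean_space"
  assumes "S \<in> sets lebesgue"
  shows "f absolutely_integrable_on S \<longleftrightarrow> integrable (lebesgue_on S) f"
  using assms by (simp add: set_integrable_def integrable_restrict_space)

lemma absolutely_integrable_continuous_mult:
  fixes f g :: "real \<Rightarrow> real"
  assumes "continuous_on {a..b} f" "g absolutely_integrable_on {a..b}"
  shows "(\<lambda>x. f x * g x) absolutely_integrable_on {a..b}"
  using assms
  by (intro absolutely_integrable_bounded_measurable_product_real)
    (auto intro: continuous_imp_measurable_on_sets_lebesgue compact_imp_bounded compact_continuous_image)

text \<open>Both sides are the integral of \<open>f y * g x\<close> over the triangle \<open>a \<le> y \<le> x \<le> b\<close>.\<close>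

lemma integral_indefinite_swap:
  fixes f g :: "real \<Rightarrow> real"
  assumes f: "f absolutely_integrable_on {a..b}" and g: "g absolutely_integrable_on {a..b}"
  shows "integral {a..b} (\<lambda>x. integral {a..x} f * g x) = integral {a..b} (\<lambda>y. f y * integral {y..b} g)"
proof -
  let ?M = "lebesgue_on {a..b}"
  have fM: "integrable ?M f" and gM: "integrable ?M g"
    using f g by (simp_all add: absolutely_integrable_iff_lebesgue_on)
  have fm[measurable]: "f \<in> borel_measurable ?M" and gm[measurable]: "g \<in> borel_measurable ?M"
    using fM gM by auto
  interpret finite_measure ?M by (rule finite_measure_lebesgue_on) simp
  interpret P: pair_sigma_finite ?M ?M ..
  have id_m[measurable]: "(\<lambda>x. x) \<in> borel_measurable ?M"
    by (intro continuous_imp_measurable_on_sets_lebesgue) auto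
  define T where "T = (\<lambda>(x, y). (if y \<le> x then f y * g x else 0))"
  have "(\<lambda>p. fst p) \<in> borel_measurable (?M \<Otimes>\<^sub>M ?M)" "(\<lambda>p. snd p) \<in> borel_measurable (?M \<Otimes>\<^sub>M ?M)"
    using measurable_compose[OF measurable_fst id_m] measurable_compose[OF measurable_snd id_m] by auto
  note [measurable] = this
  have "(\<lambda>p. f (snd p)) \<in> borel_measurable (?M \<Otimes>\<^sub>M ?M)" "(\<lambda>p. g (fst p)) \<in> borel_measurable (?M \<Otimes>\<^sub>M ?M)"
    by measurable
  note [measurable] = this
  have Tm[measurable]: "T \<in> borel_measurable (?M \<Otimes>\<^sub>M ?M)"
    unfolding T_def split_def by measurable
  have "integrable (?M \<Otimes>\<^sub>M ?M) (\<lambda>p. f (snd p) * g (fst p))"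
  proof (rule P.Fubini_integrable)
    show "integrable ?M (\<lambda>x. \<integral>y. norm (f (snd (x, y)) * g (fst (x, y))) \<partial>?M)"
      using gM by (simp add: abs_mult)
    show "AE x in ?M. integrable ?M (\<lambda>y. f (snd (x, y)) * g (fst (x, y)))"
      using fM by simp
  qed measurable
  then have Ti: "integrable (?M \<Otimes>\<^sub>M ?M) T"
    by (rule Bochner_Integration.integrable_bound) (auto simp: T_def)
  have inner1: "(\<integral>y. T (x, y) \<partial>?M) = integral {a..x} f * g x" if x: "x \<in> {a..b}" for x
  proof -
    have *: "set_integrable lebesgue {a..x} f"
      by (rule set_integrable_subset[OF f]) (use x in auto)
    have "(\<integral>y. T (x, y) \<partial>?M) = (\<integral>y. indicator {a..x} y * f y * g x \<partial>?M)"
      by (intro Bochner_Integration.integral_cong) (auto simp: T_def indicator_def)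
    also have "\<dots> = (\<integral>y. indicator {a..x} y * f y \<partial>?M) * g x" by simp
    also have "(\<integral>y. indicator {a..x} y * f y \<partial>?M) = (\<integral>y. indicator {a..x} y * f y \<partial>lebesgue)"
      using x by (subst integral_restrict_space) (auto intro!: Bochner_Integration.integral_cong simp: indicator_def)
    also have "\<dots> = integral {a..x} f"
      using set_lebesgue_integral_eq_integral(2)[OF *] by (simp add: set_lebesgue_integral_def)
    finally show ?thesis .
  qed
  have inner2: "(\<integral>x. T (x, y) \<partial>?M) = f y * integral {y..b} g" if y: "y \<in> {a..b}" for y
  proof -
    have *: "set_integrable lebesgue {y..b} g"
      by (rule set_integrable_subset[OF g]) (use y in auto)
    have "(\<integral>x. T (x, y) \<partial>?M) = (\<integral>x. f y * (indicator {y..b} x * g x) \<partial>?M)"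
      by (intro Bochner_Integration.integral_cong) (auto simp: T_def indicator_def)
    also have "\<dots> = f y * (\<integral>x. indicator {y..b} x * g x \<partial>?M)" by simp
    also have "(\<integral>x. indicator {y..b} x * g x \<partial>?M) = (\<integral>x. indicator {y..b} x * g x \<partial>lebesgue)"
      using y by (subst integral_restrict_space) (auto intro!: Bochner_Integration.integral_cong simp: indicator_def)
    also have "\<dots> = integral {y..b} g"
      using set_lebesgue_integral_eq_integral(2)[OF *] by (simp add: set_lebesgue_integral_def)
    finally show ?thesis .
  qed
  have "continuous_on {a..b} (\<lambda>x. integral {a..x} f)" "continuous_on {a..b} (\<lambda>y. integral {y..b} g)"
    using f g by (auto intro!: indefinite_integral_continuous_1 indefinite_integral_continuous_1' simp: absolutely_integrable_on_def)
  then have i1: "integrable ?M (\<lambda>x. integral {a..x} f * g x)" and "integrable ?M (\<lambda>y. integral {y..b} g * f y)"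
    using absolutely_integrable_continuous_mult[OF _ g] absolutely_integrable_continuous_mult[OF _ f]
    by (auto simp: absolutely_integrable_iff_lebesgue_on)
  then have i2: "integrable ?M (\<lambda>y. f y * integral {y..b} g)" by (simp add: mult.commute)
  have "integral {a..b} (\<lambda>x. integral {a..x} f * g x) = (\<integral>x. integral {a..x} f * g x \<partial>?M)"
    using i1 by (simp add: lebesgue_integral_eq_integral)
  also have "\<dots> = (\<integral>x. (\<integral>y. T (x, y) \<partial>?M) \<partial>?M)"
    by (intro Bochner_Integration.integral_cong) (auto simp: inner1)
  also have "\<dots> = (\<integral>y. (\<integral>x. T (x, y) \<partial>?M) \<partial>?M)"
    using P.Fubini_integral[of "\<lambda>x y. T (x, y)"] Ti by simp
  also have "\<dots> = (\<integral>y. f y * integral {y..b} g \<partial>?M)"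
    by (intro Bochner_Integration.integral_cong) (auto simp: inner2)
  also have "\<dots> = integral {a..b} (\<lambda>y. f y * integral {y..b} g)"
    using i2 by (simp add: lebesgue_integral_eq_integral)
  finally show ?thesis .
qed

text \<open>Integration by parts for absolutely continuous functions, which are given here as indefinite
  integrals: \<open>F\<close> and \<open>G\<close> need not be differentiable at any prescribed point, so the rule does
  not follow from the fundamental theorem of calculus and is reduced to Fubini's theorem.\<close>

lemma integral_by_parts_indefinite:
  fixes f g F G :: "real \<Rightarrow> real"
  assumes f: "f absolutely_integrable_on {a..b}" and g: "g absolutely_integrable_on {a..b}"
    and F: "\<And>x. x \<in> {a..b} \<Longrightarrow> F x = p + integral {a..x} f"
    and G: "\<And>x. x \<in> {a..b} \<Longrightarrow> G x = q + integral {a..x} g"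
    and ab: "a \<le> b"
  shows "integral {a..b} (\<lambda>x. F x * g x) + integral {a..b} (\<lambda>x. f x * G x) = F b * G b - F a * G a"
    and "(\<lambda>x. F x * g x) integrable_on {a..b}"
    and "(\<lambda>x. f x * G x) integrable_on {a..b}"
proof -
  have fi: "f integrable_on {a..b}" and gi: "g integrable_on {a..b}"
    using f g by (auto simp: absolutely_integrable_on_def)
  have cF0: "continuous_on {a..b} (\<lambda>x. integral {a..x} f)" and cG0: "continuous_on {a..b} (\<lambda>x. integral {a..x} g)"
    and cG1: "continuous_on {a..b} (\<lambda>x. integral {x..b} g)"
    using fi gi by (auto intro!: indefinite_integral_continuous_1 indefinite_integral_continuous_1')
  have cF: "continuous_on {a..b} F"
    by (rule continuous_on_eq[OF continuous_on_add[OF continuous_on_const cF0]]) (simp add: F)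
  have cG: "continuous_on {a..b} G"
    by (rule continuous_on_eq[OF continuous_on_add[OF continuous_on_const cG0]]) (simp add: G)
  show "(\<lambda>x. F x * g x) integrable_on {a..b}"
    using absolutely_integrable_continuous_mult[OF cF g] by (simp add: absolutely_integrable_on_def)
  show "(\<lambda>x. f x * G x) integrable_on {a..b}"
    using absolutely_integrable_continuous_mult[OF cG f] by (simp add: absolutely_integrable_on_def mult.commute)
  have i1: "(\<lambda>x. integral {a..x} f * g x) integrable_on {a..b}"
    using absolutely_integrable_continuous_mult[OF cF0 g] by (simp add: absolutely_integrable_on_def)
  have i2: "(\<lambda>x. f x * integral {x..b} g) integrable_on {a..b}"
    using absolutely_integrable_continuous_mult[OF cG1 f] by (simp add: absolutely_integrable_on_def mult.commute)
  have "integral {a..b} (\<lambda>x. F x * g x) = integral {a..b} (\<lambda>x. p * g x + integral {a..x} f * g x)"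
    by (intro integral_cong) (simp add: F algebra_simps)
  also have "\<dots> = p * integral {a..b} g + integral {a..b} (\<lambda>x. integral {a..x} f * g x)"
    using gi i1 by (subst integral_add) (auto intro: integrable_on_mult_right)
  finally have 1: "integral {a..b} (\<lambda>x. F x * g x) = p * integral {a..b} g + integral {a..b} (\<lambda>x. integral {a..x} f * g x)" .
  have "integral {a..b} (\<lambda>x. f x * G x) = integral {a..b} (\<lambda>x. f x * (q + integral {a..b} g) - f x * integral {x..b} g)"
  proof (intro integral_cong)
    fix x assume x: "x \<in> {a..b}"
    then have "integral {a..x} g + integral {x..b} g = integral {a..b} g"
      using gi by (intro Henstock_Kurzweil_Integration.integral_combine) auto
    then show "f x * G x = f x * (q + integral {a..b} g) - f x * integral {x..b} g"
      by (simp add: G[OF x] algebra_simps flip: distrib_left)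
  qed
  also have "\<dots> = integral {a..b} f * (q + integral {a..b} g) - integral {a..b} (\<lambda>x. f x * integral {x..b} g)"
    using fi i2 by (subst integral_diff) (auto intro: integrable_on_mult_left)
  finally have "integral {a..b} (\<lambda>x. F x * g x) + integral {a..b} (\<lambda>x. f x * G x)
      = p * integral {a..b} g + integral {a..b} f * (q + integral {a..b} g)"
    using 1 integral_indefinite_swap[OF f g] by simp
  then show "integral {a..b} (\<lambda>x. F x * g x) + integral {a..b} (\<lambda>x. f x * G x) = F b * G b - F a * G a"
    using ab by (simp add: F G algebra_simps)
qed

section \<open>Test functions on the circle\<close>

lemma circle_test_functionD:
  assumes "circle_test_function \<phi>"
  shows "(\<phi> has_real_derivative deriv \<phi> t) (at t)"
    and "continuous_on A \<phi>" and "continuous_on A (deriv \<phi>)" and "\<phi> pi = \<phi> (- pi)"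
proof -
  have d: "(deriv ^^ k) \<phi> differentiable (at t)" for k t
    using assms by (simp add: circle_test_function_def)
  show "(\<phi> has_real_derivative deriv \<phi> t) (at t)"
    using d[of 0 t] by (simp add: DERIV_deriv_iff_real_differentiable)
  show "continuous_on A \<phi>" "continuous_on A (deriv \<phi>)"
    using d[of 0] d[of 1] 
    by (auto intro!: differentiable_imp_continuous_on simp: differentiable_on_def differentiable_at_withinI)
  have "\<phi> (- pi + 2 * pi) = \<phi> (- pi)"
    using assms unfolding circle_test_function_def circle_periodic_def by blast
  then show "\<phi> pi = \<phi> (- pi)" by simp
qed

lemma circle_test_function_if_deriv:
  assumes "circle_test_function \<psi>" "\<And>t. (\<Phi> has_real_derivative \<psi> t) (at t)" "circle_periodic \<Phi>"
  shows "circle_test_function \<Phi>"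
proof -
  have d: "deriv \<Phi> = \<psi>"
    using assms(2) by (auto intro: DERIV_imp_deriv)
  have "(deriv ^^ k) \<Phi> differentiable (at t)" for k t
  proof (cases k)
    case 0
    then show ?thesis using assms(2)[of t] by (auto simp: real_differentiable_def)
  next
    case (Suc j)
    then show ?thesis using assms(1) by (simp add: funpow_Suc_right d circle_test_function_def del: funpow.simps)
  qed
  then show ?thesis using assms(3) by (simp add: circle_test_function_def)
qed

lemma circle_test_function_add_const:
  assumes "circle_test_function \<phi>"
  shows "circle_test_function (\<lambda>t. \<phi> t + c)"
proof -
  have "(deriv ^^ Suc k) (\<lambda>t. \<phi> t + c) = (deriv ^^ Suc k) \<phi>" for k
  proof -
    have "((\<lambda>t. \<phi> t + c) has_real_derivative deriv \<phi> t) (at t)" for t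
      using DERIV_add[OF circle_test_functionD(1)[OF assms] DERIV_const] by simp
    then have "deriv (\<lambda>t. \<phi> t + c) = deriv \<phi>" by (auto intro: DERIV_imp_deriv)
    then show ?thesis by (simp add: funpow_Suc_right del: funpow.simps)
  qed
  then have "(deriv ^^ k) (\<lambda>t. \<phi> t + c) differentiable (at t)" for k t
    using assms circle_test_functionD(1)[OF assms, of t]
    by (cases k) (auto simp: circle_test_function_def real_differentiable_def simp del: funpow.simps
        intro!: exI[of _ "deriv \<phi> t"] derivative_eq_intros)
  then show ?thesis using assms by (simp add: circle_test_function_def circle_periodic_def)
qed

lemma circle_test_function_const: "circle_test_function (\<lambda>t. c)"
proof -
  have "(deriv ^^ k) (\<lambda>t. c) = (\<lambda>t. if k = 0 then c else 0)" for k
    by (induction k) auto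
  then show ?thesis by (simp add: circle_test_function_def circle_periodic_def)
qed

text \<open>Test functions of mean zero are exactly the derivatives of test functions: the mean is the
  increment of an antiderivative over one period.\<close>

lemma circle_test_function_antiderivative:
  assumes \<psi>: "circle_test_function \<psi>" and int0: "integral {-pi..pi} \<psi> = 0"
  obtains \<Phi> where "circle_test_function \<Phi>" "deriv \<Phi> = \<psi>"
proof -
  have "isCont \<psi> t" for t
    using circle_test_functionD(1)[OF \<psi>] by (rule DERIV_isCont)
  then have "\<exists>F. \<forall>x :: real. -\<infinity> < ereal x \<longrightarrow> ereal x < \<infinity> \<longrightarrow> (F has_vector_derivative \<psi> x) (at x)"
    by (intro einterval_antiderivative) auto
  then obtain \<Phi> where \<Phi>: "\<And>x. (\<Phi> has_real_derivative \<psi> x) (at x)"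
    by (auto simp: has_real_derivative_iff_has_vector_derivative)
  have "(\<psi> has_integral (\<Phi> pi - \<Phi> (-pi))) {-pi..pi}"
    using \<Phi> by (intro fundamental_theorem_of_calculus)
      (auto simp: has_real_derivative_iff_has_vector_derivative intro: has_vector_derivative_at_within)
  with int0 have ends: "\<Phi> pi = \<Phi> (-pi)" by (simp add: integral_unique)
  have "((\<lambda>t. \<Phi> (t + 2 * pi) - \<Phi> t) has_real_derivative 0) (at t)" for t
  proof -
    have "((\<lambda>t. \<Phi> (t + 2 * pi)) has_real_derivative \<psi> (t + 2 * pi) * 1) (at t)"
      by (rule DERIV_chain'[OF _ \<Phi>]) (auto intro!: derivative_eq_intros)
    moreover have "\<psi> (t + 2 * pi) = \<psi> t"
      using \<psi> unfolding circle_test_function_def circle_periodic_def by blast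
    ultimately show ?thesis
      using DERIV_diff[OF _ \<Phi>[of t]] by fastforce
  qed
  then have "\<Phi> (t + 2 * pi) - \<Phi> t = \<Phi> (-pi + 2 * pi) - \<Phi> (-pi)" for t
    by (rule DERIV_isconst_all[rule_format, of "\<lambda>t. \<Phi> (t + 2 * pi) - \<Phi> t", rotated]) 
  then have "circle_periodic \<Phi>" using ends by (simp add: circle_periodic_def)
  then have "circle_test_function \<Phi>" by (rule circle_test_function_if_deriv[OF \<psi> \<Phi>])
  moreover have "deriv \<Phi> = \<psi>" using \<Phi> by (auto intro: DERIV_imp_deriv)
  ultimately show ?thesis by (rule that)
qed

text \<open>Trigonometric polynomials are the functions \<open>p \<circ> cis\<close> with \<open>p\<close> a polynomial in the real and
  imaginary part. They are closed under differentiation and are therefore smooth.\<close>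

lemma real_polynomial_function_cis_deriv:
  assumes "real_polynomial_function p"
  shows "\<exists>p'. real_polynomial_function p' \<and> (\<forall>t. ((\<lambda>t. p (cis t)) has_real_derivative p' (cis t)) (at t))"
  using assms
proof induction
  case (linear f)
  interpret bounded_linear f by fact
  have "((\<lambda>t. f (cis t)) has_real_derivative f (\<i> * cis t)) (at t)" for t
  proof -
    have "((\<lambda>t. exp (\<i> * of_real t)) has_vector_derivative \<i> * exp (\<i> * of_real t)) (at t)"
      by (rule has_vector_derivative_real_field) (auto intro!: derivative_eq_intros)
    then show ?thesis
      unfolding has_real_derivative_iff_has_vector_derivative
      by (intro has_vector_derivative) (simp add: cis_conv_exp)
  qed
  moreover have "bounded_linear (\<lambda>z. f (\<i> * z))"
    by (rule bounded_linear_compose[OF bounded_linear_axioms bounded_linear_mult_right])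
  ultimately show ?case by blast
next
  case (const c)
  show ?case by (intro exI[of _ "\<lambda>_. 0"]) auto
next
  case (add f g)
  then obtain f' g' where "real_polynomial_function f'" "real_polynomial_function g'"
    "\<And>t. ((\<lambda>t. f (cis t)) has_real_derivative f' (cis t)) (at t)"
    "\<And>t. ((\<lambda>t. g (cis t)) has_real_derivative g' (cis t)) (at t)" by blast
  then show ?case by (intro exI[of _ "\<lambda>z. f' z + g' z"]) (auto intro!: derivative_eq_intros)
next
  case (mult f g)
  then obtain f' g' where "real_polynomial_function f'" "real_polynomial_function g'"
    "\<And>t. ((\<lambda>t. f (cis t)) has_real_derivative f' (cis t)) (at t)"
    "\<And>t. ((\<lambda>t. g (cis t)) has_real_derivative g' (cis t)) (at t)" by blast
  then show ?case using mult.hyps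
    by (intro exI[of _ "\<lambda>z. f' z * g z + g' z * f z"]) (auto intro!: derivative_eq_intros)
qed

lemma circle_test_function_trigonometric:
  assumes "real_polynomial_function p"
  shows "circle_test_function (\<lambda>t. p (cis t))"
proof -
  have "\<exists>q. real_polynomial_function q \<and> (deriv ^^ k) (\<lambda>t. p (cis t)) = (\<lambda>t. q (cis t))" for k
  proof (induction k)
    case (Suc k)
    then obtain q where q: "real_polynomial_function q" "(deriv ^^ k) (\<lambda>t. p (cis t)) = (\<lambda>t. q (cis t))" by blast
    obtain q' where q': "real_polynomial_function q'"
      "\<And>t. ((\<lambda>t. q (cis t)) has_real_derivative q' (cis t)) (at t)"
      using real_polynomial_function_cis_deriv[OF q(1)] by blast
    have "deriv (\<lambda>t. q (cis t)) = (\<lambda>t. q' (cis t))"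
      using q'(2) by (auto intro: DERIV_imp_deriv)
    then show ?case using q q'(1) by auto
  qed (use assms in auto)
  then have "(deriv ^^ k) (\<lambda>t. p (cis t)) differentiable (at t)" for k t
    by (metis real_differentiable_def real_polynomial_function_cis_deriv)
  then show ?thesis by (simp add: circle_test_function_def circle_periodic_def flip: cis_mult)
qed

text \<open>A continuous function on the circle is a uniform limit of trigonometric polynomials by the
  theorem of Stone and Weierstrass on the unit circle. Hence \<open>V\<close> is orthogonal to itself.\<close>

lemma orthogonal_to_test_functions_imp_zero:
  assumes V: "continuous_on {-pi..pi} V" and ends: "V pi = V (-pi)"
    and orth: "\<And>\<phi>. circle_test_function \<phi> \<Longrightarrow> integral {-pi..pi} (\<lambda>t. \<phi> t * V t) = (0::real)"
    and t: "t \<in> {-pi..pi}"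
  shows "V t = 0"
proof -
  define u where "u z = V (Arg z)" for z
  have u: "u (cis t) = V t" if "t \<in> {-pi..pi}" for t
  proof (cases "t = -pi")
    case True
    have "cis (-pi) = cis pi" by (simp add: complex_eq_iff)
    then have "Arg (cis (-pi)) = pi" using Arg_cis[of pi] by (simp del: cis_pi)
    then show ?thesis by (simp add: u_def ends True)
  next
    case False
    then have "Arg (cis t) = t" using that by (intro Arg_cis) auto
    then show ?thesis by (simp add: u_def)
  qed
  have sph: "z = cis (Arg z)" "Arg z \<in> {-pi..pi}" if "z \<in> sphere 0 1" for z
    using that cis_Arg[of z] Arg_bounded[of z] by (cases "z = 0"; auto simp: sgn_eq)+
  have "continuous_on (sphere 0 1) u"
    unfolding continuous_on_closed_vimage[OF closed_sphere]
  proof (intro allI impI)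
    fix B :: "real set" assume "closed B"
    then have "compact ({-pi..pi} \<inter> V -` B)"
      using continuous_on_closed_vimage[OF closed_real_atLeastAtMost, of "-pi" pi V] V
      by (metis Int_commute compact_Icc compact_Int_closed inf.absorb_iff2 inf_le1 inf_le2)
    \<comment> \<open>Preimages of closed sets under \<open>u\<close> are images of compact sets under \<open>cis\<close>, as \<open>V\<close> agrees at
      the two parameters of the point \<open>-1\<close>.\<close>
    then have "compact (cis ` ({-pi..pi} \<inter> V -` B))"
      by (rule compact_continuous_image[rotated]) (intro continuous_intros)
    also have "cis ` ({-pi..pi} \<inter> V -` B) = u -` B \<inter> sphere 0 1"
    proof (intro equalityI subsetI)
      fix z assume "z \<in> u -` B \<inter> sphere 0 1"
      then have "z = cis (Arg z)" "Arg z \<in> {-pi..pi} \<inter> V -` B" using sph[of z] by (auto simp: u_def)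
      then show "z \<in> cis ` ({-pi..pi} \<inter> V -` B)" by blast
    qed (auto simp: u)
    finally show "closed (u -` B \<inter> sphere 0 1)" by (rule compact_imp_closed)
  qed
  note cu = this
  have V2: "continuous_on {-pi..pi} (\<lambda>t. V t * V t)" and Va: "continuous_on {-pi..pi} (\<lambda>t. \<bar>V t\<bar>)"
    using V by (auto intro!: continuous_intros)
  have "integral {-pi..pi} (\<lambda>t. V t * V t) \<le> e * integral {-pi..pi} (\<lambda>t. \<bar>V t\<bar>)" if "0 < e" for e
  proof -
    obtain p where p: "real_polynomial_function p" "\<And>z. z \<in> sphere 0 1 \<Longrightarrow> \<bar>u z - p z\<bar> < e"
      by (rule Stone_Weierstrass_real_polynomial_function[OF compact_sphere cu \<open>0 < e\<close>]) blast
    have test: "circle_test_function (\<lambda>t. p (cis t))"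
      by (rule circle_test_function_trigonometric[OF p(1)])
    have cpV: "continuous_on {-pi..pi} (\<lambda>t. p (cis t) * V t)"
      using V circle_test_functionD(2)[OF test] by (intro continuous_intros)
    have "integral {-pi..pi} (\<lambda>t. V t * V t) = integral {-pi..pi} (\<lambda>t. V t * V t - p (cis t) * V t)"
      using orth[OF test] V2 cpV by (subst integral_diff) (auto intro: integrable_continuous_real)
    also have "\<dots> \<le> integral {-pi..pi} (\<lambda>t. e * \<bar>V t\<bar>)"
    proof (rule integral_le)
      fix t assume t: "t \<in> {-pi..pi}"
      have "\<bar>V t - p (cis t)\<bar> \<le> e" using p(2)[of "cis t"] u[OF t] by simp
      then have "\<bar>V t - p (cis t)\<bar> * \<bar>V t\<bar> \<le> e * \<bar>V t\<bar>" by (rule mult_right_mono) simp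
      then have "\<bar>(V t - p (cis t)) * V t\<bar> \<le> e * \<bar>V t\<bar>" by (simp add: abs_mult)
      then show "V t * V t - p (cis t) * V t \<le> e * \<bar>V t\<bar>" by (simp add: algebra_simps)
    qed (use V2 cpV Va in \<open>auto intro!: integrable_continuous_real continuous_intros\<close>)
    finally show ?thesis by simp
  qed
  note bound = this
  let ?A = "integral {-pi..pi} (\<lambda>t. \<bar>V t\<bar>)"
  have A: "0 \<le> ?A"
    by (intro integral_nonneg integrable_continuous_real Va) auto
  have "integral {-pi..pi} (\<lambda>t. V t * V t) \<le> 0 + e" if e: "0 < e" for e
  proof -
    have "e / (?A + 1) * ?A \<le> e" using A e by (simp add: field_simps)
    then show ?thesis using bound[of "e / (?A + 1)"] A e by simp
  qed
  then have "integral {-pi..pi} (\<lambda>t. V t * V t) \<le> 0"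
    by (rule field_le_epsilon)
  moreover have "0 \<le> integral {-pi..pi} (\<lambda>t. V t * V t)"
    by (intro integral_nonneg integrable_continuous_real V2) auto
  ultimately have "integral {-pi..pi} (\<lambda>t. V t * V t) = 0" by simp
  then have "V t * V t = 0"
    using integral_eq_0_iff[OF V2] t pi_gt_zero by simp
  then show ?thesis by simp
qed

section \<open>Weak derivatives and indefinite integrals\<close>

lemma test_function_by_parts:
  assumes \<phi>: "circle_test_function \<phi>" and g: "g absolutely_integrable_on {-pi..pi}"
    and G: "\<And>x. x \<in> {-pi..pi} \<Longrightarrow> G x = q + integral {-pi..x} g"
  shows "integral {-pi..pi} (\<lambda>t. deriv \<phi> t * G t)
    = \<phi> pi * integral {-pi..pi} g - integral {-pi..pi} (\<lambda>t. \<phi> t * g t)"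
proof -
  have d: "deriv \<phi> absolutely_integrable_on {-pi..pi}"
    by (intro absolutely_integrable_continuous_real circle_test_functionD(3)[OF \<phi>])
  have "\<phi> x = \<phi> (-pi) + integral {-pi..x} (deriv \<phi>)" if "x \<in> {-pi..pi}" for x
  proof -
    have "(deriv \<phi> has_integral (\<phi> x - \<phi> (-pi))) {-pi..x}"
      using that circle_test_functionD(1)[OF \<phi>]
      by (intro fundamental_theorem_of_calculus)
        (auto simp: has_real_derivative_iff_has_vector_derivative intro: has_vector_derivative_at_within)
    then show ?thesis by (simp add: integral_unique)
  qed
  from integral_by_parts_indefinite(1)[OF d g this G]
  have "integral {-pi..pi} (\<lambda>t. \<phi> t * g t) + integral {-pi..pi} (\<lambda>t. deriv \<phi> t * G t)
    = \<phi> pi * G pi - \<phi> (-pi) * G (-pi)" by simp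
  then show ?thesis
    using G[of pi] G[of "-pi"] circle_test_functionD(4)[OF \<phi>] by (simp add: algebra_simps)
qed

text \<open>After its mean is removed, any test function is a derivative.\<close>

lemma weakly_constant:
  assumes w: "w absolutely_integrable_on {-pi..pi}"
    and orth: "\<And>\<phi>. circle_test_function \<phi> \<Longrightarrow> integral {-pi..pi} (\<lambda>t. deriv \<phi> t * w t) = (0::real)"
    and \<phi>: "circle_test_function \<phi>"
  shows "integral {-pi..pi} (\<lambda>t. \<phi> t * (w t - integral {-pi..pi} w / (2 * pi))) = 0"
proof -
  let ?W = "integral {-pi..pi} w" and ?m = "integral {-pi..pi} \<phi> / (2 * pi)"
  have wi: "w integrable_on {-pi..pi}" using w by (simp add: absolutely_integrable_on_def)
  have \<phi>i: "\<phi> integrable_on {-pi..pi}"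
    by (intro integrable_continuous_real circle_test_functionD(2)[OF \<phi>])
  have \<phi>w: "(\<lambda>t. \<phi> t * w t) integrable_on {-pi..pi}"
    using absolutely_integrable_continuous_mult[OF circle_test_functionD(2)[OF \<phi>] w]
    by (simp add: absolutely_integrable_on_def)
  have "circle_test_function (\<lambda>t. \<phi> t + - ?m)"
    by (rule circle_test_function_add_const[OF \<phi>])
  moreover have "integral {-pi..pi} (\<lambda>t. \<phi> t + - ?m) = 0"
    using \<phi>i by (subst integral_add) auto
  ultimately obtain \<Phi> where "circle_test_function \<Phi>" "deriv \<Phi> = (\<lambda>t. \<phi> t + - ?m)"
    by (rule circle_test_function_antiderivative)
  then have "0 = integral {-pi..pi} (\<lambda>t. (\<phi> t + - ?m) * w t)"
    using orth[of \<Phi>] by simp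
  also have "\<dots> = integral {-pi..pi} (\<lambda>t. \<phi> t * w t - ?m * w t)"
    by (simp add: algebra_simps)
  also have "\<dots> = integral {-pi..pi} (\<lambda>t. \<phi> t * w t) - ?m * ?W"
    using \<phi>w wi by (subst integral_diff) (auto intro: integrable_on_mult_right)
  also have "\<dots> = integral {-pi..pi} (\<lambda>t. \<phi> t * w t) - integral {-pi..pi} \<phi> * (?W / (2 * pi))"
    by simp
  also have "\<dots> = integral {-pi..pi} (\<lambda>t. \<phi> t * w t - \<phi> t * (?W / (2 * pi)))"
    using \<phi>w \<phi>i by (subst integral_diff) (auto intro!: integrable_on_mult_left simp del: times_divide_eq_right)
  finally show ?thesis by (simp only: right_diff_distrib)
qed

text \<open>The conclusion says \<open>f = k + \<integral> g\<close> almost everywhere, in the integrated form that is used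
  below. With \<open>G\<close> the indefinite integral of \<open>g\<close>, the function \<open>f - G\<close> has weak derivative zero;
  the indefinite integral \<open>V\<close> of its deviation \<open>v\<close> from the mean is continuous and again weakly
  constant, so that orthogonality to test functions makes it vanish pointwise.\<close>

lemma du_Bois_Reymond:
  fixes f g :: "real \<Rightarrow> real"
  assumes f: "f absolutely_integrable_on {-pi..pi}" and g: "g absolutely_integrable_on {-pi..pi}"
    and weak: "\<And>\<phi>. circle_test_function \<phi> \<Longrightarrow>
      integral {-pi..pi} (\<lambda>t. deriv \<phi> t * f t) = - integral {-pi..pi} (\<lambda>t. \<phi> t * g t)"
  shows "integral {-pi..pi} g = 0"
    and "\<exists>k. \<forall>t\<in>{-pi..pi}. integral {-pi..t} f = integral {-pi..t} (\<lambda>x. k + integral {-pi..x} g)"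
proof -
  show g0: "integral {-pi..pi} g = 0"
    using weak[OF circle_test_function_const[of 1]] by simp
  define G where "G x = integral {-pi..x} g" for x
  have cG: "continuous_on {-pi..pi} G"
    using g unfolding G_def by (auto intro!: indefinite_integral_continuous_1 simp: absolutely_integrable_on_def)
  then have Ga: "G absolutely_integrable_on {-pi..pi}" by (rule absolutely_integrable_continuous_real)
  define w where "w t = f t - G t" for t
  have w: "w absolutely_integrable_on {-pi..pi}"
    unfolding w_def by (rule set_integral_diff(1)[OF f Ga])
  have w_orth: "integral {-pi..pi} (\<lambda>t. deriv \<phi> t * w t) = 0" if \<phi>: "circle_test_function \<phi>" for \<phi>
  proof -
    have "(\<lambda>t. deriv \<phi> t * f t) integrable_on {-pi..pi}" "(\<lambda>t. deriv \<phi> t * G t) integrable_on {-pi..pi}"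
      using absolutely_integrable_continuous_mult[OF circle_test_functionD(3)[OF \<phi>] f]
        absolutely_integrable_continuous_mult[OF circle_test_functionD(3)[OF \<phi>] Ga]
      by (simp_all add: absolutely_integrable_on_def)
    then have "integral {-pi..pi} (\<lambda>t. deriv \<phi> t * w t)
      = integral {-pi..pi} (\<lambda>t. deriv \<phi> t * f t) - integral {-pi..pi} (\<lambda>t. deriv \<phi> t * G t)"
      unfolding w_def right_diff_distrib by (rule integral_diff)
    also have "\<dots> = 0"
      using test_function_by_parts[OF \<phi> g, of G 0] weak[OF \<phi>] by (simp add: G_def g0)
    finally show ?thesis .
  qed
  define k where "k = integral {-pi..pi} w / (2 * pi)"
  define v where "v t = w t - k" for t
  have wi: "w integrable_on {-pi..pi}" using w by (simp add: absolutely_integrable_on_def)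
  have v: "v absolutely_integrable_on {-pi..pi}"
    unfolding v_def by (rule set_integral_diff(1)[OF w]) (rule absolutely_integrable_continuous_real[OF continuous_on_const])
  have vi: "v integrable_on {-pi..pi}" using v by (simp add: absolutely_integrable_on_def)
  define V where "V x = integral {-pi..x} v" for x
  have v0: "integral {-pi..pi} v = 0"
    using wi unfolding v_def by (subst integral_diff) (auto simp: k_def)
  have cV: "continuous_on {-pi..pi} V"
    using vi unfolding V_def by (rule indefinite_integral_continuous_1)
  then have Va: "V absolutely_integrable_on {-pi..pi}" by (rule absolutely_integrable_continuous_real)
  define k' where "k' = integral {-pi..pi} V / (2 * pi)"
  have "integral {-pi..pi} (\<lambda>t. deriv \<phi> t * V t) = 0" if \<phi>: "circle_test_function \<phi>" for \<phi>
  proof -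
    have "integral {-pi..pi} (\<lambda>t. \<phi> t * v t) = 0"
      using weakly_constant[OF w w_orth \<phi>] by (simp add: v_def k_def)
    then show ?thesis
      using test_function_by_parts[OF \<phi> v, of V 0] by (simp add: V_def v0)
  qed
  from weakly_constant[OF Va this]
  have "integral {-pi..pi} (\<lambda>t. \<phi> t * (V t - k')) = 0" if "circle_test_function \<phi>" for \<phi>
    using that by (simp add: k'_def)
  then have V_const: "V t - k' = 0" if "t \<in> {-pi..pi}" for t
    using cV v0 that
    by (intro orthogonal_to_test_functions_imp_zero[of "\<lambda>t. V t - k'"]) (auto intro!: continuous_intros simp: V_def)
  then have "V t = 0" if "t \<in> {-pi..pi}" for t
    using V_const[of "-pi"] V_const[OF that] by (simp add: V_def)
  moreover have "V t = integral {-pi..t} f - integral {-pi..t} (\<lambda>x. k + G x)" if t: "t \<in> {-pi..pi}" for t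
  proof -
    have "f integrable_on {-pi..t}" "G integrable_on {-pi..t}"
      using f Ga t by (auto simp: absolutely_integrable_on_def intro: integrable_on_subinterval)
    then have "integral {-pi..t} (\<lambda>x. f x - (k + G x)) = integral {-pi..t} f - integral {-pi..t} (\<lambda>x. k + G x)"
      by (intro integral_diff integrable_add) auto
    moreover have "v = (\<lambda>x. f x - (k + G x))" by (auto simp: v_def w_def)
    ultimately show ?thesis by (simp add: V_def)
  qed
  ultimately have "\<forall>t\<in>{-pi..pi}. integral {-pi..t} f = integral {-pi..t} (\<lambda>x. k + G x)" by simp
  then show "\<exists>k. \<forall>t\<in>{-pi..pi}. integral {-pi..t} f = integral {-pi..t} (\<lambda>x. k + integral {-pi..x} g)"
    unfolding G_def by blast
qed

lemma continuous_eq_if_indefinite_integral_eq: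
  fixes f g :: "real \<Rightarrow> 'a::banach"
  assumes "continuous_on {a..b} f" "continuous_on {a..b} g" "a < b"
    and eq: "\<And>t. t \<in> {a..b} \<Longrightarrow> integral {a..t} f = integral {a..t} g"
    and x: "x \<in> {a..b}"
  shows "f x = g x"
proof -
  have "((\<lambda>t. integral {a..t} f) has_vector_derivative f x) (at x within {a..b})"
    by (rule integral_has_vector_derivative[OF assms(1) x])
  then have "((\<lambda>t. integral {a..t} g) has_vector_derivative f x) (at x within {a..b})"
    by (rule has_vector_derivative_transform[OF x, rotated]) (simp add: eq)
  moreover have "((\<lambda>t. integral {a..t} g) has_vector_derivative g x) (at x within {a..b})"
    by (rule integral_has_vector_derivative[OF assms(2) x])
  ultimately show ?thesis
    using vector_derivative_unique_within_closed_interval[of a b x] assms(3) x by (metis box_real(2))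
qed

lemma circle_L2_absolutely_integrable:
  fixes u :: "real \<Rightarrow> 'a::euclidean_space"
  assumes "circle_L2 u"
  shows "u absolutely_integrable_on {-pi..pi}"
proof -
  have m: "u \<in> borel_measurable circle_measure" and i: "integrable circle_measure (\<lambda>t. (norm (u t))\<^sup>2)"
    using assms by (auto simp: circle_L2_def)
  have "integrable circle_measure (\<lambda>t. 1 + (norm (u t))\<^sup>2)"
    using i by simp
  then have "integrable circle_measure u"
  proof (rule Bochner_Integration.integrable_bound[OF _ m])
    have "x \<le> 1 + x\<^sup>2" for x :: real
      using zero_le_power2[of "x - 1/2"] by (simp add: power2_eq_square algebra_simps)
    then show "AE x in circle_measure. norm (u x) \<le> norm (1 + (norm (u x))\<^sup>2)" by simp
  qed
  then show ?thesis by (simp add: absolutely_integrable_iff_lebesgue_on)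
qed

lemma circle_integral_scaleR_inner:
  fixes u :: "real \<Rightarrow> 'a::euclidean_space"
  assumes \<psi>: "continuous_on {-pi..pi} \<psi>" and u: "u absolutely_integrable_on {-pi..pi}"
  shows "(\<integral>t. \<psi> t *\<^sub>R u t \<partial>circle_measure) \<bullet> b = integral {-pi..pi} (\<lambda>t. \<psi> t * (u t \<bullet> b))"
proof -
  have "(\<lambda>t. \<psi> t *\<^sub>R u t) absolutely_integrable_on {-pi..pi}"
    using \<psi>
    by (intro absolutely_integrable_bounded_measurable_product[where h = "(*\<^sub>R)", OF _ _ _ _ u]
        continuous_imp_measurable_on_sets_lebesgue compact_imp_bounded compact_continuous_image)
      (auto simp: bilinear_conv_bounded_bilinear bounded_bilinear_scaleR)
  then have i: "integrable circle_measure (\<lambda>t. \<psi> t *\<^sub>R u t)"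
    by (simp add: absolutely_integrable_iff_lebesgue_on)
  then have "(\<integral>t. \<psi> t *\<^sub>R u t \<partial>circle_measure) \<bullet> b = (\<integral>t. (\<psi> t *\<^sub>R u t) \<bullet> b \<partial>circle_measure)"
    by (intro integral_inner_left[symmetric])
  also have "\<dots> = integral {-pi..pi} (\<lambda>t. (\<psi> t *\<^sub>R u t) \<bullet> b)"
    using integrable_inner_left[OF i] by (intro lebesgue_integral_eq_integral) auto
  finally show ?thesis by simp
qed

lemma integral_inner:
  fixes u :: "real \<Rightarrow> 'a::euclidean_space"
  assumes "u integrable_on S"
  shows "integral S u \<bullet> b = integral S (\<lambda>t. u t \<bullet> b)"
  using integral_linear[OF assms bounded_linear_inner_left[of b]] by (simp add: o_def)

text \<open>The vector-valued form of \<open>du_Bois_Reymond\<close>, obtained coordinate by coordinate.\<close>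

lemma has_circle_weak_derivD:
  fixes f :: "real \<Rightarrow> 'a::euclidean_space"
  assumes "has_circle_weak_deriv f g"
  shows "f absolutely_integrable_on {-pi..pi}" "g absolutely_integrable_on {-pi..pi}"
    and "integral {-pi..pi} g = 0"
    and "\<exists>k. \<forall>t\<in>{-pi..pi}. integral {-pi..t} f = integral {-pi..t} (\<lambda>x. k + integral {-pi..x} g)"
proof -
  show f: "f absolutely_integrable_on {-pi..pi}" and g: "g absolutely_integrable_on {-pi..pi}"
    using assms circle_L2_absolutely_integrable by (auto simp: has_circle_weak_deriv_def)
  have comp: "(\<lambda>t. u t \<bullet> b) absolutely_integrable_on {-pi..pi}"
    if "u absolutely_integrable_on {-pi..pi}" for u :: "real \<Rightarrow> 'a" and b
    using absolutely_integrable_component[OF that] .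
  have weak: "integral {-pi..pi} (\<lambda>t. deriv \<phi> t * (f t \<bullet> b)) = - integral {-pi..pi} (\<lambda>t. \<phi> t * (g t \<bullet> b))"
    if \<phi>: "circle_test_function \<phi>" for \<phi> b
  proof -
    have "(\<integral>t. deriv \<phi> t *\<^sub>R f t \<partial>circle_measure) = - (\<integral>t. \<phi> t *\<^sub>R g t \<partial>circle_measure)"
      using assms \<phi> by (simp add: has_circle_weak_deriv_def)
    then have "(\<integral>t. deriv \<phi> t *\<^sub>R f t \<partial>circle_measure) \<bullet> b = - ((\<integral>t. \<phi> t *\<^sub>R g t \<partial>circle_measure) \<bullet> b)"
      by simp
    then show ?thesis
      by (simp only: circle_integral_scaleR_inner[OF circle_test_functionD(2)[OF \<phi>] g]
        circle_integral_scaleR_inner[OF circle_test_functionD(3)[OF \<phi>] f])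
  qed
  have gi: "g integrable_on {-pi..pi}" and fi: "f integrable_on {-pi..pi}"
    using f g by (auto simp: absolutely_integrable_on_def)
  have "integral {-pi..pi} g \<bullet> b = 0" for b
    unfolding integral_inner[OF gi] by (rule du_Bois_Reymond(1)[OF comp[OF f] comp[OF g] weak])
  then show "integral {-pi..pi} g = 0" by (metis inner_eq_zero_iff)
  have "\<forall>b. \<exists>k. \<forall>t\<in>{-pi..pi}. integral {-pi..t} (\<lambda>t. f t \<bullet> b) = integral {-pi..t} (\<lambda>x. k + integral {-pi..x} (\<lambda>t. g t \<bullet> b))"
    by (intro allI du_Bois_Reymond(2)[OF comp[OF f] comp[OF g] weak])
  then obtain k where k: "\<And>b t. t\<in>{-pi..pi} \<Longrightarrow> integral {-pi..t} (\<lambda>t. f t \<bullet> b) = integral {-pi..t} (\<lambda>x. k b + integral {-pi..x} (\<lambda>t. g t \<bullet> b))"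
    by metis
  define K where "K = (\<Sum>b\<in>Basis. k b *\<^sub>R b)"
  have "integral {-pi..t} f = integral {-pi..t} (\<lambda>x. K + integral {-pi..x} g)" if t: "t \<in> {-pi..pi}" for t
  proof (rule euclidean_eqI)
    fix b :: 'a assume b: "b \<in> Basis"
    have sub: "u integrable_on {-pi..x}" if "u integrable_on {-pi..pi}" "x \<in> {-pi..pi}" for x and u :: "real \<Rightarrow> 'a"
      using that by (auto intro: integrable_on_subinterval)
    have "continuous_on {-pi..t} (\<lambda>x. integral {-pi..x} g)"
      using indefinite_integral_continuous_1[OF gi] t by (auto intro: continuous_on_subset)
    then have "continuous_on {-pi..t} (\<lambda>x. K + integral {-pi..x} g)" by (intro continuous_intros)
    then have "integral {-pi..t} (\<lambda>x. K + integral {-pi..x} g) \<bullet> b = integral {-pi..t} (\<lambda>x. (K + integral {-pi..x} g) \<bullet> b)"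
      by (intro integral_inner integrable_continuous_real)
    also have "\<dots> = integral {-pi..t} (\<lambda>x. k b + integral {-pi..x} (\<lambda>t. g t \<bullet> b))"
    proof (rule integral_cong)
      fix x assume "x \<in> {-pi..t}"
      then have "integral {-pi..x} g \<bullet> b = integral {-pi..x} (\<lambda>t. g t \<bullet> b)"
        using t by (intro integral_inner sub[OF gi]) auto
      moreover have "K \<bullet> b = k b" unfolding K_def by (rule inner_sum_left_Basis[OF b])
      ultimately show "(K + integral {-pi..x} g) \<bullet> b = k b + integral {-pi..x} (\<lambda>t. g t \<bullet> b)"
        by (simp only: inner_add_left)
    qed
    also have "\<dots> = integral {-pi..t} (\<lambda>t. f t \<bullet> b)" using k[OF t] by simp
    also have "\<dots> = integral {-pi..t} f \<bullet> b" using integral_inner[OF sub[OF fi t]] by simp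
    finally show "integral {-pi..t} f \<bullet> b = integral {-pi..t} (\<lambda>x. K + integral {-pi..x} g) \<bullet> b" by simp
  qed
  then show "\<exists>k. \<forall>t\<in>{-pi..pi}. integral {-pi..t} f = integral {-pi..t} (\<lambda>x. k + integral {-pi..x} g)" by blast
qed

section \<open>Tangents of curves with finite bending energy\<close>

lemma emeasure_lebesgue_on_point:
  assumes "S \<in> sets lebesgue" "x \<in> S"
  shows "emeasure (lebesgue_on S) {x::real} = 0" "{x} \<in> sets (lebesgue_on S)"
  using assms by (auto simp: emeasure_restrict_space sets_restrict_space image_iff intro!: bexI[of _ "{x}"])

text \<open>Applying the du Bois-Reymond lemma twice shows that an \<open>H\<^sup>2\<close> curve is \<open>C\<^sup>1\<close> with absolutely
  continuous derivative \<open>U\<close>. Continuity upgrades \<open>norm U = c\<close> from almost everywhere to everywhere,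
  and injectivity excludes \<open>c = 0\<close>. The pointwise derivative is only controlled in the open
  interval, where it agrees with \<open>U\<close>; the endpoints form a null set.\<close>

lemma constant_speed_H2_tangent:
  assumes emb: "circle_embedding \<gamma>" and speed: "constant_speed \<gamma>" and H2: "circle_H2 \<gamma>"
  obtains c U where "0 < c" "continuous_on {-pi..pi} U"
    "\<And>t. t \<in> {-pi..pi} \<Longrightarrow> norm (U t) = c"
    "\<And>t. t \<in> {-pi<..<pi} \<Longrightarrow> (\<gamma> has_vector_derivative U t) (at t)"
    "circle_weak_deriv (velocity \<gamma>) absolutely_integrable_on {-pi..pi}"
    "\<And>t. t \<in> {-pi..pi} \<Longrightarrow> U t = U (-pi) + integral {-pi..t} (circle_weak_deriv (velocity \<gamma>))"
proof -
  obtain g h where g: "has_circle_weak_deriv \<gamma> g" and h: "has_circle_weak_deriv g h"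
    using H2 by (auto simp: circle_H2_def)
  have ha: "h absolutely_integrable_on {-pi..pi}" and h0: "integral {-pi..pi} h = 0"
    using has_circle_weak_derivD[OF h] by auto
  have gi: "g integrable_on {-pi..pi}" and hi: "h integrable_on {-pi..pi}"
    using has_circle_weak_derivD[OF g] ha by (auto simp: absolutely_integrable_on_def)
  obtain k1 where k1: "\<And>t. t\<in>{-pi..pi} \<Longrightarrow> integral {-pi..t} \<gamma> = integral {-pi..t} (\<lambda>x. k1 + integral {-pi..x} g)"
    using has_circle_weak_derivD(4)[OF g] by blast
  obtain k2 where k2: "\<And>t. t\<in>{-pi..pi} \<Longrightarrow> integral {-pi..t} g = integral {-pi..t} (\<lambda>x. k2 + integral {-pi..x} h)"
    using has_circle_weak_derivD(4)[OF h] by blast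
  define U where "U x = k2 + integral {-pi..x} h" for x
  have cU: "continuous_on {-pi..pi} U"
    unfolding U_def by (intro continuous_intros indefinite_integral_continuous_1 hi)
  have \<gamma>_eq: "\<gamma> t = k1 + integral {-pi..t} U" if t: "t \<in> {-pi..pi}" for t
  proof -
    have "\<gamma> t = k1 + integral {-pi..t} g"
    proof (rule continuous_eq_if_indefinite_integral_eq[of "-pi" pi])
      show "continuous_on {-pi..pi} \<gamma>"
        using emb by (auto simp: circle_embedding_def intro: continuous_on_subset)
      show "continuous_on {-pi..pi} (\<lambda>x. k1 + integral {-pi..x} g)"
        by (intro continuous_intros indefinite_integral_continuous_1 gi)
    qed (use k1 t in auto)
    also have "integral {-pi..t} g = integral {-pi..t} U"
      using k2[OF t] unfolding U_def .
    finally show ?thesis .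
  qed
  have deriv: "(\<gamma> has_vector_derivative U t) (at t)" if t: "t \<in> {-pi<..<pi}" for t
  proof -
    have "((\<lambda>x. integral {-pi..x} U) has_vector_derivative U t) (at t within {-pi..pi})"
      using t by (intro integral_has_vector_derivative cU) auto
    then have "((\<lambda>x. integral {-pi..x} U) has_vector_derivative U t) (at t)"
      using at_within_interior[of t "{-pi..pi}"] t by simp
    then have "((\<lambda>x. k1 + integral {-pi..x} U) has_vector_derivative U t) (at t)"
      using has_vector_derivative_add[OF has_vector_derivative_const[of k1]] by force
    then show ?thesis
    proof (rule has_vector_derivative_transform_within_open[OF _ open_greaterThanLessThan t])
      show "k1 + integral {-pi..x} U = \<gamma> x" if "x \<in> {-pi<..<pi}" for x
        using that by (intro \<gamma>_eq[symmetric]) auto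
    qed
  qed
  then have vel: "velocity \<gamma> t = U t" if "t \<in> {-pi<..<pi}" for t
    using that unfolding velocity_def by (intro vector_derivative_at) auto
  obtain c where c: "AE t in lebesgue. \<gamma> differentiable (at t) \<and> norm (velocity \<gamma> t) = c"
    using speed by (auto simp: constant_speed_def)
  have norm_int: "norm (U t) = c" if t: "t \<in> {-pi<..<pi}" for t
  proof -
    \<comment> \<open>An open null set is empty.\<close>
    let ?N = "{t \<in> {-pi<..<pi}. norm (U t) \<noteq> c}"
    have "continuous_on {-pi<..<pi} (\<lambda>t. norm (U t))"
      using cU by (intro continuous_intros) (auto intro: continuous_on_subset)
    then have "open ({-pi<..<pi} \<inter> (\<lambda>t. norm (U t)) -` (- {c}))"
      by (intro continuous_open_preimage) auto
    moreover have "{-pi<..<pi} \<inter> (\<lambda>t. norm (U t)) -` (- {c}) = ?N" by auto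
    ultimately have o: "open ?N" by simp
    have "AE t in lebesgue. t \<notin> ?N"
      using c
    proof eventually_elim
      case (elim x)
      then show ?case using vel[of x] by auto
    qed
    moreover have "?N \<in> sets lebesgue" using o by (intro sets_completionI_sets) (simp only: sets_lborel borel_open)
    ultimately have "negligible ?N" by (simp only: negligible_iff_null_sets AE_iff_null_sets)
    then have "?N = {}" using o open_not_negligible by blast
    then show ?thesis using t by blast
  qed
  have norm_U: "norm (U t) = c" if t: "t \<in> {-pi..pi}" for t
  proof (rule continuous_constant_on_closure[of "{-pi<..<pi}" "\<lambda>t. norm (U t)"])
    show "continuous_on (closure {-pi<..<pi}) (\<lambda>t. norm (U t))"
      using cU by (simp add: continuous_on_norm)
  qed (use norm_int t in auto)
  have "c \<noteq> 0"
  proof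
    assume "c = 0"
    then have "integral {-pi..0} U = 0" 
      using norm_U by (subst integral_cong[of _ _ "\<lambda>_. 0"]) auto
    then have "\<gamma> 0 = \<gamma> (-pi)" by (simp add: \<gamma>_eq)
    moreover have "inj_on \<gamma> {-pi..<pi}" using emb by (simp add: circle_embedding_def)
    ultimately show False by (auto dest!: inj_onD)
  qed
  moreover have "0 \<le> c" using norm_U[of 0] norm_ge_zero[of "U 0"] by simp
  ultimately have c0: "0 < c" by simp
  have Ua: "U absolutely_integrable_on {-pi..pi}" by (rule absolutely_integrable_continuous_real[OF cU])
  have eq_ae: "U x = velocity \<gamma> x" if "x \<in> space circle_measure" "x \<notin> {-pi, pi}" for x
    using that vel by auto
  have pts: "emeasure circle_measure {x} = 0" "{x} \<in> sets circle_measure" if "x \<in> {-pi, pi}" for x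
    using that by (auto intro!: emeasure_lebesgue_on_point)
  have Um: "U \<in> borel_measurable circle_measure"
    by (intro continuous_imp_measurable_on_sets_lebesgue cU) auto
  then have vm: "velocity \<gamma> \<in> borel_measurable circle_measure"
    by (rule measurable_discrete_difference[of _ _ _ "{-pi, pi}"]) (use pts eq_ae in auto)
  have "(\<lambda>t. (norm (U t))\<^sup>2) absolutely_integrable_on {-pi..pi}"
    by (intro absolutely_integrable_continuous_real continuous_intros cU)
  then have "integrable circle_measure (\<lambda>t. (norm (U t))\<^sup>2)"
    by (simp add: absolutely_integrable_iff_lebesgue_on)
  then have "integrable circle_measure (\<lambda>t. (norm (velocity \<gamma> t))\<^sup>2)"
    by (subst (asm) integrable_discrete_difference[of "{-pi, pi}" _ _ "\<lambda>t. (norm (velocity \<gamma> t))\<^sup>2"])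
      (use pts eq_ae in auto)
  then have "circle_L2 (velocity \<gamma>)" using vm by (simp add: circle_L2_def)
  moreover have "circle_L2 h" using h by (simp add: has_circle_weak_deriv_def)
  moreover have "(\<integral>t. deriv \<phi> t *\<^sub>R velocity \<gamma> t \<partial>circle_measure) = - (\<integral>t. \<phi> t *\<^sub>R h t \<partial>circle_measure)"
    if \<phi>: "circle_test_function \<phi>" for \<phi>
  proof (rule euclidean_eqI)
    fix b :: "real^3"
    have "(\<integral>t. deriv \<phi> t *\<^sub>R velocity \<gamma> t \<partial>circle_measure) = (\<integral>t. deriv \<phi> t *\<^sub>R U t \<partial>circle_measure)"
      by (rule integral_discrete_difference[of "{-pi, pi}"]) (use pts eq_ae in auto)
    also have "\<dots> \<bullet> b = integral {-pi..pi} (\<lambda>t. deriv \<phi> t * (U t \<bullet> b))"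
      by (rule circle_integral_scaleR_inner[OF circle_test_functionD(3)[OF \<phi>] Ua])
    also have "\<dots> = \<phi> pi * integral {-pi..pi} (\<lambda>t. h t \<bullet> b) - integral {-pi..pi} (\<lambda>t. \<phi> t * (h t \<bullet> b))"
    proof (rule test_function_by_parts[OF \<phi> absolutely_integrable_component[OF ha]])
      fix x assume "x \<in> {-pi..pi}"
      then have "h integrable_on {-pi..x}" using hi by (auto intro: integrable_on_subinterval)
      then show "U x \<bullet> b = k2 \<bullet> b + integral {-pi..x} (\<lambda>t. h t \<bullet> b)"
        unfolding U_def inner_add_left by (simp only: integral_inner)
    qed
    also have "integral {-pi..pi} (\<lambda>t. h t \<bullet> b) = 0"
      using integral_inner[OF hi, of b] h0 by simp
    also have "integral {-pi..pi} (\<lambda>t. \<phi> t * (h t \<bullet> b)) = (\<integral>t. \<phi> t *\<^sub>R h t \<partial>circle_measure) \<bullet> b"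
      by (rule circle_integral_scaleR_inner[OF circle_test_functionD(2)[OF \<phi>] ha, symmetric])
    finally show "(\<integral>t. deriv \<phi> t *\<^sub>R velocity \<gamma> t \<partial>circle_measure) \<bullet> b = - (\<integral>t. \<phi> t *\<^sub>R h t \<partial>circle_measure) \<bullet> b"
      by simp
  qed
  \<comment> \<open>Only the existence of some weak derivative of the velocity is known so far; the one that the
    choice operator picks is then related to \<open>U\<close> by the du Bois-Reymond lemma once more.\<close>
  ultimately have "has_circle_weak_deriv (velocity \<gamma>) h"
    by (simp add: has_circle_weak_deriv_def)
  then have wd: "has_circle_weak_deriv (velocity \<gamma>) (circle_weak_deriv (velocity \<gamma>))" (is "has_circle_weak_deriv _ ?h")
    unfolding circle_weak_deriv_def by (rule someI[of "has_circle_weak_deriv (velocity \<gamma>)"])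
  note wdD = has_circle_weak_derivD[OF wd]
  have hi': "?h integrable_on {-pi..pi}" using wdD(2) by (simp add: absolutely_integrable_on_def)
  obtain k where k: "\<And>t. t\<in>{-pi..pi} \<Longrightarrow> integral {-pi..t} (velocity \<gamma>) = integral {-pi..t} (\<lambda>x. k + integral {-pi..x} ?h)"
    using wdD(4) by blast
  have U_eq: "U t = k + integral {-pi..t} ?h" if t: "t \<in> {-pi..pi}" for t
  proof (rule continuous_eq_if_indefinite_integral_eq[OF cU _ _ _ t])
    show "continuous_on {-pi..pi} (\<lambda>x. k + integral {-pi..x} ?h)"
      by (intro continuous_intros indefinite_integral_continuous_1 hi')
    show "integral {-pi..t} U = integral {-pi..t} (\<lambda>x. k + integral {-pi..x} ?h)" if "t \<in> {-pi..pi}" for t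
      unfolding k[OF that, symmetric]
      by (rule integral_spike[of "{-pi, pi}"]) (use that vel in auto)
  qed simp
  show ?thesis
  proof (rule that[OF c0 cU norm_U deriv wdD(2)])
    show "U t = U (-pi) + integral {-pi..t} ?h" if "t \<in> {-pi..pi}" for t
      using U_eq[OF that] U_eq[of "-pi"] by simp
  qed
qed

text \<open>The integral of \<open>U \<bullet> U'\<close> is half the increment of \<open>norm U ^ 2\<close>.\<close>

lemma tangent_derivative_orthogonal:
  fixes U h :: "real \<Rightarrow> real^'n"
  assumes ha: "h absolutely_integrable_on {a..b}" and ab: "a \<le> b"
    and U: "\<And>x. x \<in> {a..b} \<Longrightarrow> U x = U a + integral {a..x} h"
    and norm_eq: "norm (U a) = norm (U b)"
  shows "integral {a..b} (\<lambda>t. U t \<bullet> h t) = 0"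
proof -
  have comp: "(\<lambda>t. h t $ i) absolutely_integrable_on {a..b}" for i
    using absolutely_integrable_component[OF ha, of "axis i 1"] by (simp add: inner_axis)
  have Ui: "U x $ i = U a $ i + integral {a..x} (\<lambda>t. h t $ i)" if "x \<in> {a..b}" for x i
  proof -
    have "h integrable_on {a..x}"
      using ha that by (auto simp: absolutely_integrable_on_def intro: integrable_on_subinterval)
    from integral_inner[OF this, of "axis i 1"] have "integral {a..x} h $ i = integral {a..x} (\<lambda>t. h t $ i)"
      by (simp add: inner_axis)
    then show ?thesis using U[OF that] by simp
  qed
  note parts = integral_by_parts_indefinite[OF comp comp Ui Ui ab]
  have "integral {a..b} (\<lambda>t. U t $ i * h t $ i) = ((U b $ i)\<^sup>2 - (U a $ i)\<^sup>2) / 2" for i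
    using parts(1)[of i i] by (simp add: mult.commute[of "h _ $ i"] power2_eq_square)
  note component = this
  have "integral {a..b} (\<lambda>t. U t \<bullet> h t) = (\<Sum>i\<in>UNIV. integral {a..b} (\<lambda>t. U t $ i * h t $ i))"
    unfolding inner_vec_def using parts(2) by (subst integral_sum) auto
  also have "\<dots> = (\<Sum>i\<in>UNIV. ((U b $ i)\<^sup>2 - (U a $ i)\<^sup>2) / 2)"
    by (simp only: component)
  also have "\<dots> = ((norm (U b))\<^sup>2 - (norm (U a))\<^sup>2) / 2"
    unfolding power2_norm_eq_inner inner_vec_def
    by (simp add: sum_subtractf power2_eq_square flip: sum_divide_distrib)
  finally show ?thesis using norm_eq by simp
qed

section \<open>The modulus of continuity of the tangent\<close>

text \<open>The arithmetic-geometric mean inequality with a free scale \<open>k\<close>: it bounds the integral of \<open>q\<close> by the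
  length of the interval and the integral of \<open>q ^ 2\<close>.\<close>

lemma le_half_add_square_div:
  fixes k q :: real
  assumes "0 < k"
  shows "q \<le> k / 2 + q\<^sup>2 * (1 / (2 * k))"
proof -
  have "0 \<le> (k - q)\<^sup>2 / (2 * k)" using assms by simp
  also have "\<dots> = k / 2 + q\<^sup>2 * (1 / (2 * k)) - q"
    using assms by (simp add: field_simps power2_eq_square)
  finally show ?thesis by simp
qed

text \<open>Only the part of \<open>h = U'\<close> orthogonal to \<open>U\<close> is controlled by the curvature. The tangential part
  \<open>u = U \<bullet> h\<close> integrates to zero over every subinterval since \<open>norm U\<close> is constant, and an integration
  by parts shows that then \<open>u U\<close> integrates to zero as well. Testing \<open>h\<close> against the chord \<open>z\<close> and using
  \<open>(U \<times> z) \<bullet> (U \<times> h) = norm U ^ 2 * (z \<bullet> h) - u * (z \<bullet> U)\<close>, one bounds \<open>norm z\<close> by a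
  multiple of the integral of \<open>norm (U \<times> h)\<close>. The parameter \<open>\<mu>\<close> is free and yields equicontinuity when it is chosen
  large and then \<open>t - s\<close> small.\<close>

lemma tangent_modulus:
  fixes U h :: "real \<Rightarrow> real^3"
  assumes ha: "h absolutely_integrable_on {a..b}"
    and U: "\<And>x. x \<in> {a..b} \<Longrightarrow> U x = U a + integral {a..x} h"
    and cU: "continuous_on {a..b} U"
    and norm_U: "\<And>x. x \<in> {a..b} \<Longrightarrow> norm (U x) = c" and c: "0 < c"
    and q: "(\<lambda>x. (norm (cross3 (U x) (h x)))\<^sup>2) integrable_on {a..b}"
    and Q: "integral {a..b} (\<lambda>x. (norm (cross3 (U x) (h x)))\<^sup>2) \<le> Q"
    and \<mu>: "0 < \<mu>" and st: "a \<le> s" "s \<le> t" "t \<le> b"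
  shows "norm (U t - U s) \<le> (c * \<mu> * (t - s) + Q / (c ^ 3 * \<mu>)) / 2"
proof -
  define z where "z = U t - U s"
  define u where "u x = U x \<bullet> h x" for x
  have sub: "{s..t} \<subseteq> {a..b}" using st by auto
  have hs: "h absolutely_integrable_on {s..t}"
    using ha st by (auto intro: set_integrable_subset)
  have hi: "h integrable_on {a..b}" using ha by (simp add: absolutely_integrable_on_def)
  have his: "h integrable_on {s..t}" using hs by (simp add: absolutely_integrable_on_def)
  have cUs: "continuous_on {s..t} U" by (rule continuous_on_subset[OF cU sub])
  have Us: "U x = U s + integral {s..x} h" if x: "x \<in> {s..t}" for x
  proof -
    have "integral {a..s} h + integral {s..x} h = integral {a..x} h"
      using st x by (intro Henstock_Kurzweil_Integration.integral_combine integrable_on_subinterval[OF hi]) auto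
    then show ?thesis using U[of x] U[of s] st x by (simp add: algebra_simps)
  qed
  have ua: "u absolutely_integrable_on {s..t}"
    unfolding u_def
    by (intro absolutely_integrable_bounded_measurable_product[where h = "(\<bullet>)", OF _ _ _ _ hs]
        continuous_imp_measurable_on_sets_lebesgue compact_imp_bounded compact_continuous_image cUs)
      (auto simp: bilinear_conv_bounded_bilinear bounded_bilinear_inner)
  have u0: "integral {s..x} u = 0" if x: "x \<in> {s..t}" for x
    unfolding u_def
  proof (rule tangent_derivative_orthogonal)
    show "h absolutely_integrable_on {s..x}"
      by (rule set_integrable_subset[OF hs]) (use x in auto)
    show "U y = U s + integral {s..y} h" if "y \<in> {s..x}" for y using that x by (intro Us) auto
    show "norm (U s) = norm (U x)" using x st norm_U by simp
  qed (use x in auto)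
  have comp: "(\<lambda>x. h x $ i) absolutely_integrable_on {s..t}" for i
    using absolutely_integrable_component[OF hs, of "axis i 1"] by (simp add: inner_axis)
  have Ui: "U x $ i = U s $ i + integral {s..x} (\<lambda>y. h y $ i)" if x: "x \<in> {s..t}" for x i
  proof -
    have "h integrable_on {s..x}" using his x by (auto intro: integrable_on_subinterval)
    from integral_inner[OF this, of "axis i 1"] have "integral {s..x} h $ i = integral {s..x} (\<lambda>y. h y $ i)"
      by (simp add: inner_axis)
    then show ?thesis using Us[OF x] by simp
  qed
  have F0: "0 = 0 + integral {s..x} u" if "x \<in> {s..t}" for x using u0[OF that] by simp
  have uU: "integral {s..t} (\<lambda>x. u x * U x $ i) = 0" "(\<lambda>x. u x * U x $ i) integrable_on {s..t}" for i
    using integral_by_parts_indefinite(1,3)[OF ua comp F0 Ui st(2), of i] by simp_all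
  have z_eq: "u x * (z \<bullet> U x) = (\<Sum>i\<in>UNIV. z $ i * (u x * U x $ i))" for x
    by (simp add: inner_vec_def sum_distrib_left algebra_simps)
  have uz: "integral {s..t} (\<lambda>x. u x * (z \<bullet> U x)) = 0" 
    unfolding z_eq using uU by (subst integral_sum) (auto intro: integrable_on_mult_right)
  have uzi: "(\<lambda>x. u x * (z \<bullet> U x)) integrable_on {s..t}"
    unfolding z_eq using uU by (intro integrable_sum) (auto intro: integrable_on_mult_right)
  have hz: "integral {s..t} (\<lambda>x. h x \<bullet> z) = (norm z)\<^sup>2" "(\<lambda>x. h x \<bullet> z) integrable_on {s..t}"
    using integral_inner[OF his, of z] Us[of t] st absolutely_integrable_component[OF hs, of z]
    by (simp_all add: z_def power2_norm_eq_inner absolutely_integrable_on_def)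
  let ?p = "\<lambda>x. cross3 (U x) z \<bullet> cross3 (U x) (h x)" and ?q = "\<lambda>x. norm (cross3 (U x) (h x))"
  have p_eq: "?p x = c\<^sup>2 * (h x \<bullet> z) - u x * (z \<bullet> U x)" if "x \<in> {s..t}" for x
    using norm_U[of x] that sub
    by (auto simp: dot_cross u_def inner_commute[of z] simp flip: power2_norm_eq_inner)
  have p_int: "integral {s..t} ?p = c\<^sup>2 * (norm z)\<^sup>2"
  proof -
    have "integral {s..t} ?p = integral {s..t} (\<lambda>x. c\<^sup>2 * (h x \<bullet> z) - u x * (z \<bullet> U x))"
      by (intro integral_cong p_eq)
    also have "\<dots> = c\<^sup>2 * (norm z)\<^sup>2"
      using hz uz uzi by (subst integral_diff) (auto intro: integrable_on_mult_right)
    finally show ?thesis .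
  qed
  have p_i: "?p integrable_on {s..t}"
    using hz(2) uzi by (subst integrable_cong[OF p_eq]) (auto intro!: integrable_diff integrable_on_mult_right)
  have qs: "(\<lambda>x. (?q x)\<^sup>2) integrable_on {s..t}"
    using q st by (auto intro: integrable_on_subinterval)
  let ?r = "\<lambda>x. c * norm z * (c\<^sup>2 * \<mu> / 2 + (?q x)\<^sup>2 * (1 / (2 * c\<^sup>2 * \<mu>)))"
  have "c\<^sup>2 * (norm z)\<^sup>2 \<le> integral {s..t} ?r"
    unfolding p_int[symmetric]
  proof (rule integral_le[OF p_i])
    show "?r integrable_on {s..t}"
      using qs by (intro integrable_on_mult_right integrable_add integrable_on_mult_left) auto
    fix x assume x: "x \<in> {s..t}"
    have "(norm (cross3 (U x) z))\<^sup>2 \<le> (c * norm z)\<^sup>2"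
      using norm_cross[of "U x" z] norm_U[of x] x sub by (auto simp: power_mult_distrib)
    then have 1: "norm (cross3 (U x) z) \<le> c * norm z"
      by (rule power2_le_imp_le) (use c in simp)
    have "?p x \<le> norm (cross3 (U x) z) * ?q x" by (rule norm_cauchy_schwarz)
    also have "\<dots> \<le> c * norm z * ?q x" by (intro mult_right_mono 1) simp
    also have "\<dots> \<le> ?r x"
    proof (rule mult_left_mono)
      show "?q x \<le> c\<^sup>2 * \<mu> / 2 + (?q x)\<^sup>2 * (1 / (2 * c\<^sup>2 * \<mu>))"
        using le_half_add_square_div[of "c\<^sup>2 * \<mu>" "?q x"] c \<mu> by (simp add: mult.assoc)
    qed (use c in simp)
    finally show "?p x \<le> ?r x" .
  qed
  also have "integral {s..t} ?r = c * norm z * (c\<^sup>2 * \<mu> / 2 * (t - s) + integral {s..t} (\<lambda>x. (?q x)\<^sup>2) * (1 / (2 * c\<^sup>2 * \<mu>)))"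
  proof -
    have "integral {s..t} (\<lambda>x. c\<^sup>2 * \<mu> / 2 + (?q x)\<^sup>2 * (1 / (2 * c\<^sup>2 * \<mu>)))
      = integral {s..t} (\<lambda>x. c\<^sup>2 * \<mu> / 2) + integral {s..t} (\<lambda>x. (?q x)\<^sup>2 * (1 / (2 * c\<^sup>2 * \<mu>)))"
      by (intro integral_add integrable_on_mult_left qs) auto
    also have "\<dots> = c\<^sup>2 * \<mu> / 2 * (t - s) + integral {s..t} (\<lambda>x. (?q x)\<^sup>2) * (1 / (2 * c\<^sup>2 * \<mu>))"
      using st by (simp only: integral_mult_left) simp
    finally show ?thesis by (simp only: integral_mult_right)
  qed
  also have "\<dots> \<le> c * norm z * (c\<^sup>2 * \<mu> / 2 * (t - s) + Q * (1 / (2 * c\<^sup>2 * \<mu>)))"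
  proof (intro mult_left_mono add_left_mono mult_right_mono)
    have "integral {s..t} (\<lambda>x. (?q x)\<^sup>2) \<le> integral {a..b} (\<lambda>x. (?q x)\<^sup>2)"
      by (rule integral_subset_le[OF sub qs q]) simp
    then show "integral {s..t} (\<lambda>x. (?q x)\<^sup>2) \<le> Q" using Q by linarith
  qed (use c \<mu> in auto)
  also have "\<dots> = c\<^sup>2 * norm z * ((c * \<mu> * (t - s) + Q / (c ^ 3 * \<mu>)) / 2)"
    using c \<mu> by (simp add: field_simps power2_eq_square power3_eq_cube)
  finally have "(c\<^sup>2 * norm z) * norm z \<le> (c\<^sup>2 * norm z) * ((c * \<mu> * (t - s) + Q / (c ^ 3 * \<mu>)) / 2)"
    by (simp add: power2_eq_square mult.assoc)
  moreover have "0 \<le> Q"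
    using Q integral_nonneg[OF q] by (smt (verit) zero_le_power2)
  then have "0 \<le> (c * \<mu> * (t - s) + Q / (c ^ 3 * \<mu>)) / 2"
    using c \<mu> st by (intro divide_nonneg_nonneg add_nonneg_nonneg mult_nonneg_nonneg) auto
  ultimately show ?thesis
    unfolding z_def[symmetric] using c by (cases "z = 0") auto
qed

lemma arc_length_constant_speed:
  assumes "\<And>t. t \<in> {-pi<..<pi} \<Longrightarrow> norm (velocity \<gamma> t) = c" and "-pi \<le> s" "s \<le> t" "t \<le> pi"
  shows "arc_length \<gamma> s t = c * (t - s)"
proof -
  have "arc_length \<gamma> s t = (\<integral>x. c \<partial>lebesgue_on {s..t})"
    unfolding arc_length_def
    by (rule integral_discrete_difference[of "{-pi, pi} \<inter> {s..t}"])
      (use assms emeasure_lebesgue_on_point in auto)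
  also have "\<dots> = c * (t - s)"
    using assms by (simp add: measure_restrict_space)
  finally show ?thesis .
qed

text \<open>For speed \<open>c\<close> the curvature is \<open>q / c ^ 3\<close>, so the bending energy equals
  \<open>(\<integral> q ^ 2) / (2 * pi * c ^ 4)\<close>.\<close>

lemma bounded_bending_energy:
  assumes c: "0 < c" and cU: "continuous_on {-pi..pi} U"
    and norm_U: "\<And>t. t \<in> {-pi..pi} \<Longrightarrow> norm (U t) = c"
    and vel: "\<And>t. t \<in> {-pi<..<pi} \<Longrightarrow> velocity \<gamma> t = U t"
    and ha: "circle_weak_deriv (velocity \<gamma>) absolutely_integrable_on {-pi..pi}"
    and E: "bending_energy \<gamma> \<le> ennreal C" and H2: "circle_H2 \<gamma>" and C: "0 \<le> C"
  defines "q \<equiv> \<lambda>t. norm (cross3 (U t) (circle_weak_deriv (velocity \<gamma>) t))"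
  shows "(\<lambda>t. (q t)\<^sup>2) integrable_on {-pi..pi}"
    and "integral {-pi..pi} (\<lambda>t. (q t)\<^sup>2) \<le> 2 * pi * C * c ^ 4"
proof -
  let ?h = "circle_weak_deriv (velocity \<gamma>)"
  have "(\<lambda>t. cross3 (U t) (?h t)) absolutely_integrable_on {-pi..pi}"
    by (intro absolutely_integrable_bounded_measurable_product[where h = cross3, OF _ _ _ _ ha]
        continuous_imp_measurable_on_sets_lebesgue compact_imp_bounded compact_continuous_image cU bilinear_cross)
      auto
  then have [measurable]: "(\<lambda>t. cross3 (U t) (?h t)) \<in> borel_measurable circle_measure"
    by (simp add: absolutely_integrable_iff_lebesgue_on)
  have qm[measurable]: "q \<in> borel_measurable circle_measure"
    unfolding q_def by measurable
  have len: "curve_len \<gamma> = c * (2 * pi)"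
    unfolding curve_len_def using arc_length_constant_speed[of \<gamma> c "-pi" pi] vel norm_U by simp
  have "AE t in circle_measure. t \<notin> {-pi, pi}"
    by (rule AE_discrete_difference) (auto intro!: emeasure_lebesgue_on_point)
  then have ae: "AE t in circle_measure. ennreal ((curvature \<gamma> t)\<^sup>2 * norm (velocity \<gamma> t)) = ennreal ((q t)\<^sup>2 / c ^ 5)"
    using AE_space
  proof eventually_elim
    case (elim t)
    then have t: "t \<in> {-pi<..<pi}" by auto
    then have "norm (velocity \<gamma> t) = c" using vel norm_U by simp
    then have "(curvature \<gamma> t)\<^sup>2 * norm (velocity \<gamma> t) = (q t / c ^ 3)\<^sup>2 * c"
      using vel[OF t] by (simp add: curvature_def q_def)
    also have "\<dots> = (q t)\<^sup>2 / c ^ 5" using c by (simp add: field_simps eval_nat_numeral)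
    finally show ?case by simp
  qed
  let ?I = "\<integral>\<^sup>+t. ennreal ((q t)\<^sup>2 / c ^ 5) \<partial>circle_measure"
  have "bending_energy \<gamma> = ennreal c * (ennreal (1 / (2 * pi)) * ?I)"
    using H2 nn_integral_cong_AE[OF ae] by (simp add: bending_energy_def len)
  also have "\<dots> = ennreal (c / (2 * pi)) * ?I"
    using c by (simp add: mult.assoc[symmetric] ennreal_mult[symmetric])
  finally have bound: "ennreal (c / (2 * pi)) * ?I \<le> ennreal C" using E by simp
  then have "?I \<noteq> \<infinity>"
    using c by (auto simp: ennreal_mult_top top_unique)
  then have fin: "?I < \<infinity>" by (simp add: less_top)
  then have i: "integrable circle_measure (\<lambda>t. (q t)\<^sup>2 / c ^ 5)"
    using c by (intro integrableI_nonneg) auto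
  have I_eq: "?I = ennreal (\<integral>t. (q t)\<^sup>2 / c ^ 5 \<partial>circle_measure)"
    using i c by (intro nn_integral_eq_integral) auto
  have "integrable circle_measure (\<lambda>t. c ^ 5 * ((q t)\<^sup>2 / c ^ 5))" by (intro integrable_mult_right i)
  then have i2: "integrable circle_measure (\<lambda>t. (q t)\<^sup>2)" using c by simp
  then show "(\<lambda>t. (q t)\<^sup>2) integrable_on {-pi..pi}" by (intro integrable_on_lebesgue_on) auto
  have "ennreal (c / (2 * pi) * ((\<integral>t. (q t)\<^sup>2 \<partial>circle_measure) / c ^ 5)) \<le> ennreal C"
    using bound c unfolding I_eq by (subst ennreal_mult) auto
  then have "c / (2 * pi) * ((\<integral>t. (q t)\<^sup>2 \<partial>circle_measure) / c ^ 5) \<le> C"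
    using C by (simp only: ennreal_le_iff)
  then have "(\<integral>t. (q t)\<^sup>2 \<partial>circle_measure) \<le> 2 * pi * C * c ^ 4"
    using c by (simp add: field_simps eval_nat_numeral)
  then show "integral {-pi..pi} (\<lambda>t. (q t)\<^sup>2) \<le> 2 * pi * C * c ^ 4"
    using i2 by (simp add: lebesgue_integral_eq_integral)
qed

section \<open>Compactness\<close>

lemma range_circle_periodic:
  assumes "circle_periodic \<gamma>"
  shows "range \<gamma> = \<gamma> ` {-pi..<pi}"
proof -
  interpret periodic_fun_simple \<gamma> "2 * pi"
    by unfold_locales (use assms in \<open>simp add: circle_periodic_def\<close>)
  have "\<gamma> x \<in> \<gamma> ` {-pi..<pi}" for x
  proof -
    define n where "n = \<lfloor>(x + pi) / (2 * pi)\<rfloor>"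
    have "of_int n \<le> (x + pi) / (2 * pi)" "(x + pi) / (2 * pi) < of_int n + 1"
      unfolding n_def by linarith+
    then have "x - of_int n * (2 * pi) \<in> {-pi..<pi}"
      by (simp add: field_simps)
    moreover have "\<gamma> (x - of_int n * (2 * pi)) = \<gamma> x" by (rule minus_of_int)
    ultimately show ?thesis by (metis imageI)
  qed
  then show ?thesis by auto
qed

text \<open>All constants are independent of the speed \<open>c\<close>: the scale-invariant energy controls the modulus of
  continuity of the unit tangent \<open>T\<close>, and the distortion controls the inverse of the
  parametrization.\<close>

lemma bounded_curve_unit_tangent:
  assumes emb: "circle_embedding \<gamma>" and speed: "constant_speed \<gamma>"
    and E: "bending_energy \<gamma> \<le> ennreal C" and C: "0 < C"
    and dist: "distortion \<gamma> \<le> ennreal D" and D: "0 < D"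
  obtains c T where "0 < c" "\<And>t. t \<in> {-pi..pi} \<Longrightarrow> norm (T t) = 1"
    "\<And>t. t \<in> {-pi<..<pi} \<Longrightarrow> (\<gamma> has_vector_derivative c *\<^sub>R T t) (at t)"
    "\<And>\<mu> s t. 0 < \<mu> \<Longrightarrow> -pi \<le> s \<Longrightarrow> s \<le> t \<Longrightarrow> t \<le> pi \<Longrightarrow> norm (T t - T s) \<le> \<mu> * (t - s) / 2 + pi * C / \<mu>"
    "\<And>s t. -pi \<le> s \<Longrightarrow> s < t \<Longrightarrow> t < pi \<Longrightarrow> c * min (t - s) (2 * pi - (t - s)) \<le> D * norm (\<gamma> s - \<gamma> t)"
proof -
  have H2: "circle_H2 \<gamma>"
    using E by (auto simp: bending_energy_def top_unique split: if_splits)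
  let ?h = "circle_weak_deriv (velocity \<gamma>)"
  obtain c U where c: "0 < c" and cU: "continuous_on {-pi..pi} U"
    and norm_U: "\<And>t. t \<in> {-pi..pi} \<Longrightarrow> norm (U t) = c"
    and deriv: "\<And>t. t \<in> {-pi<..<pi} \<Longrightarrow> (\<gamma> has_vector_derivative U t) (at t)"
    and ha: "?h absolutely_integrable_on {-pi..pi}"
    and U: "\<And>t. t \<in> {-pi..pi} \<Longrightarrow> U t = U (-pi) + integral {-pi..t} ?h"
    using constant_speed_H2_tangent[OF emb speed H2] by metis
  have vel: "velocity \<gamma> t = U t" if "t \<in> {-pi<..<pi}" for t
    unfolding velocity_def by (rule vector_derivative_at[OF deriv[OF that]])
  note energy = bounded_bending_energy[OF c cU norm_U vel ha E H2 less_imp_le[OF C]]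
  define T where "T t = U t /\<^sub>R c" for t
  show ?thesis
  proof (rule that[OF c, of T])
    show "norm (T t) = 1" if "t \<in> {-pi..pi}" for t using norm_U[OF that] c by (simp add: T_def)
    show "(\<gamma> has_vector_derivative c *\<^sub>R T t) (at t)" if "t \<in> {-pi<..<pi}" for t
      using deriv[OF that] c by (simp add: T_def)
    show "norm (T t - T s) \<le> \<mu> * (t - s) / 2 + pi * C / \<mu>"
      if "0 < \<mu>" "-pi \<le> s" "s \<le> t" "t \<le> pi" for \<mu> s t
    proof -
      have "norm (U t - U s) \<le> (c * \<mu> * (t - s) + 2 * pi * C * c ^ 4 / (c ^ 3 * \<mu>)) / 2"
        by (rule tangent_modulus[OF ha U cU norm_U c energy that])
      also have "\<dots> = c * (\<mu> * (t - s) / 2 + pi * C / \<mu>)"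
        using c \<open>0 < \<mu>\<close> by (simp add: field_simps eval_nat_numeral)
      finally have "norm (U t - U s) / c \<le> \<mu> * (t - s) / 2 + pi * C / \<mu>"
        using c by (simp add: divide_le_eq mult.commute)
      moreover have "norm (T t - T s) = norm (U t - U s) / c"
        using c by (simp add: T_def divide_inverse mult.commute flip: scaleR_diff_right)
      ultimately show ?thesis by simp
    qed
    show "c * min (t - s) (2 * pi - (t - s)) \<le> D * norm (\<gamma> s - \<gamma> t)" if st: "-pi \<le> s" "s < t" "t < pi" for s t
    proof -
      have speed_c: "\<And>t. t \<in> {-pi<..<pi} \<Longrightarrow> norm (velocity \<gamma> t) = c"
        using vel norm_U by simp
      have "curve_dist \<gamma> s t = min (c * (t - s)) (c * (2 * pi) - c * (t - s))"
        unfolding curve_dist_def curve_len_def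
        using arc_length_constant_speed[OF speed_c, of s t] arc_length_constant_speed[OF speed_c, of "-pi" pi] st
        by simp
      also have "\<dots> = c * min (t - s) (2 * pi - (t - s))"
        using c by (simp add: min_mult_distrib_left algebra_simps)
      finally have cd: "curve_dist \<gamma> s t = c * min (t - s) (2 * pi - (t - s))" .
      have "ennreal (curve_dist \<gamma> s t / dist (\<gamma> s) (\<gamma> t)) \<le> distortion \<gamma>"
        unfolding distortion_def by (rule SUP_upper2[of "(s, t)"]) (use st in auto)
      then have "ennreal (curve_dist \<gamma> s t / dist (\<gamma> s) (\<gamma> t)) \<le> ennreal D"
        using \<open>distortion \<gamma> \<le> ennreal D\<close> by (rule order_trans)
      then have "curve_dist \<gamma> s t / dist (\<gamma> s) (\<gamma> t) \<le> D" using D by simp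
      moreover have "\<gamma> s \<noteq> \<gamma> t"
        using emb st by (auto simp: circle_embedding_def dest!: inj_onD)
      ultimately show ?thesis
        unfolding cd by (simp add: dist_norm divide_le_eq)
    qed
  qed
qed

text \<open>Integrate the difference of the tangents along either of the two arcs from \<open>s\<close> to \<open>t\<close>; the arc through
  the cut point \<open>\<plusminus>pi\<close> is split there.\<close>

lemma close_tangents_imp_close_curves:
  fixes \<gamma> \<eta> :: "real \<Rightarrow> 'a::euclidean_space"
  assumes periodic: "circle_periodic \<gamma>" "circle_periodic \<eta>"
    and cont: "continuous_on UNIV \<gamma>" "continuous_on UNIV \<eta>"
    and pos: "0 < c" "0 < c'"
    and deriv: "\<And>t. t \<in> {-pi<..<pi} \<Longrightarrow> (\<gamma> has_vector_derivative c *\<^sub>R T t) (at t)"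
      "\<And>t. t \<in> {-pi<..<pi} \<Longrightarrow> (\<eta> has_vector_derivative c' *\<^sub>R T' t) (at t)"
    and close: "\<And>t. t \<in> {-pi..pi} \<Longrightarrow> norm (T' t - T t) \<le> \<epsilon>"
    and st: "-pi \<le> s" "s \<le> t" "t \<le> pi"
  defines "f \<equiv> \<lambda>t. \<eta> t /\<^sub>R (c' / c) - \<gamma> t"
  shows "norm (f s - f t) \<le> c * \<epsilon> * min (t - s) (2 * pi - (t - s))"
proof -
  have lip: "norm (f y - f x) \<le> c * \<epsilon> * (y - x)" if xy: "-pi \<le> x" "x \<le> y" "y \<le> pi" for x y
  proof (cases "x = y")
    case False
    then have "x < y" using xy by simp
    then have "norm (f y - f x) \<le> c * \<epsilon> * y - c * \<epsilon> * x"
    proof (rule differentiable_bound_general)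
      show "continuous_on {x..y} f"
        unfolding f_def using cont by (auto intro!: continuous_intros intro: continuous_on_subset)
      show "continuous_on {x..y} (\<lambda>z. c * \<epsilon> * z)" by (intro continuous_intros)
      fix z assume "x < z" "z < y"
      then have z: "z \<in> {-pi<..<pi}" using xy by auto
      have "(f has_vector_derivative (c' *\<^sub>R T' z) /\<^sub>R (c' / c) - c *\<^sub>R T z) (at z)"
        unfolding f_def
        by (intro has_vector_derivative_diff deriv z bounded_linear.has_vector_derivative[OF bounded_linear_scaleR_right])
      also have "(c' *\<^sub>R T' z) /\<^sub>R (c' / c) - c *\<^sub>R T z = c *\<^sub>R (T' z - T z)"
        using pos by (simp add: scaleR_diff_right)
      finally show "(f has_vector_derivative c *\<^sub>R (T' z - T z)) (at z)" .
      show "((\<lambda>z. c * \<epsilon> * z) has_vector_derivative c * \<epsilon>) (at z)"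
        unfolding has_real_derivative_iff_has_vector_derivative[symmetric]
        by (auto intro!: derivative_eq_intros)
      show "norm (c *\<^sub>R (T' z - T z)) \<le> c * \<epsilon>"
        using close[of z] z pos by simp
    qed
    then show ?thesis by (simp add: algebra_simps)
  qed simp
  have per: "\<gamma> pi = \<gamma> (-pi)" "\<eta> pi = \<eta> (-pi)"
    using periodic[unfolded circle_periodic_def] by (auto dest: spec[of _ "-pi"])
  then have ends: "f pi = f (-pi)" by (simp add: f_def)
  have "norm (f s - f t) \<le> c * \<epsilon> * (t - s)"
    using lip[of s t] st by (simp add: norm_minus_commute)
  moreover have "norm (f s - f t) \<le> c * \<epsilon> * (2 * pi - (t - s))"
  proof -
    have "norm (f s - f t) \<le> norm (f s - f (-pi)) + norm (f pi - f t)"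
      using norm_triangle_ineq[of "f s - f (-pi)" "f pi - f t"] by (simp add: ends)
    also have "\<dots> \<le> c * \<epsilon> * (s - (-pi)) + c * \<epsilon> * (pi - t)"
      using st by (intro add_mono lip) auto
    finally show ?thesis by (simp add: algebra_simps)
  qed
  ultimately show ?thesis by (simp add: min_def)
qed

theorem mainTheorem5:
  shows "\<not> (\<exists>\<gamma> :: nat \<Rightarrow> real \<Rightarrow> real^3.
      (\<forall>n. circle_embedding (\<gamma> n) \<and> constant_speed (\<gamma> n)) \<and>
      (\<forall>m n. m \<noteq> n \<longrightarrow> \<not> ambient_isotopic (range (\<gamma> m)) (range (\<gamma> n))) \<and>
      (\<exists>C :: real. \<forall>n. distortion (\<gamma> n) \<le> ennreal C) \<and>
      (\<exists>C :: real. \<forall>n. bending_energy (\<gamma> n) \<le> ennreal C))"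
proof (rule notI, elim exE conjE)
  fix \<gamma> :: "nat \<Rightarrow> real \<Rightarrow> real^3" and D0 C0 :: real
  assume curves: "\<forall>n. circle_embedding (\<gamma> n) \<and> constant_speed (\<gamma> n)"
    and distinct: "\<forall>m n. m \<noteq> n \<longrightarrow> \<not> ambient_isotopic (range (\<gamma> m)) (range (\<gamma> n))"
    and "\<forall>n. distortion (\<gamma> n) \<le> ennreal D0" and "\<forall>n. bending_energy (\<gamma> n) \<le> ennreal C0"
  then have D0: "distortion (\<gamma> n) \<le> ennreal D0" and C0: "bending_energy (\<gamma> n) \<le> ennreal C0" for n
    by simp_all
  have emb: "circle_embedding (\<gamma> n)" and speed: "constant_speed (\<gamma> n)" for n
    using curves by simp_all
  define C D where "C = max C0 1" and "D = max D0 1"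
  have pos: "0 < C" "0 < D" by (simp_all add: C_def D_def)
  have dist: "distortion (\<gamma> n) \<le> ennreal D" and E: "bending_energy (\<gamma> n) \<le> ennreal C" for n
    by (rule order_trans[OF D0 ennreal_leI], simp add: D_def)
      (rule order_trans[OF C0 ennreal_leI], simp add: C_def)
  define tangent where "tangent n c T \<longleftrightarrow> 0 < c \<and> (\<forall>t\<in>{-pi..pi}. norm (T t) = 1)
    \<and> (\<forall>t\<in>{-pi<..<pi}. (\<gamma> n has_vector_derivative c *\<^sub>R T t) (at t))
    \<and> (\<forall>\<mu> s t. 0 < \<mu> \<longrightarrow> -pi \<le> s \<longrightarrow> s \<le> t \<longrightarrow> t \<le> pi \<longrightarrow>
          norm (T t - T s) \<le> \<mu> * (t - s) / 2 + pi * C / \<mu>)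
    \<and> (\<forall>s t. -pi \<le> s \<longrightarrow> s < t \<longrightarrow> t < pi \<longrightarrow>
          c * min (t - s) (2 * pi - (t - s)) \<le> D * norm (\<gamma> n s - \<gamma> n t))" for n c T
  have "\<exists>c T. tangent n c T" for n
  proof (rule bounded_curve_unit_tangent[OF emb speed E pos(1) dist pos(2), of n], goal_cases)
    case (1 c T)
    then show ?case by (intro exI[of _ c] exI[of _ T]) (simp add: tangent_def)
  qed
  then obtain c T where ex: "\<And>n. tangent n (c n) (T n)" by metis
  have c: "0 < c n" and norm_T: "t \<in> {-pi..pi} \<Longrightarrow> norm (T n t) = 1"
    and deriv: "t \<in> {-pi<..<pi} \<Longrightarrow> (\<gamma> n has_vector_derivative c n *\<^sub>R T n t) (at t)"
    and modulus: "0 < \<mu> \<Longrightarrow> -pi \<le> s \<Longrightarrow> s \<le> t \<Longrightarrow> t \<le> pi \<Longrightarrow>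
      norm (T n t - T n s) \<le> \<mu> * (t - s) / 2 + pi * C / \<mu>"
    and bilip: "-pi \<le> s \<Longrightarrow> s < t \<Longrightarrow> t < pi \<Longrightarrow>
      c n * min (t - s) (2 * pi - (t - s)) \<le> D * norm (\<gamma> n s - \<gamma> n t)" for n \<mu> s t
    using ex[of n] unfolding tangent_def by blast+
  have equicont: "\<exists>d. 0 < d \<and> (\<forall>n y. y \<in> {-pi..pi} \<and> norm (x - y) < d \<longrightarrow> norm (T n x - T n y) < e)"
    if x: "x \<in> {-pi..pi}" and e: "0 < e" for x e
  proof -
    \<comment> \<open>This makes the term \<open>pi * C / \<mu>\<close> of the modulus equal to half of \<open>e\<close>.\<close>
    define \<mu> where "\<mu> = 2 * pi * C / e"
    have \<mu>: "0 < \<mu>" and half: "pi * C / \<mu> = e / 2" using pos e by (auto simp: \<mu>_def field_simps)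
    have mod: "norm (T n t - T n s) < e" if "-pi \<le> s" "s \<le> t" "t \<le> pi" "t - s < e / \<mu>" for n s t
    proof -
      have "\<mu> * (t - s) / 2 < e / 2" using that(4) \<mu> by (simp add: field_simps)
      then have "\<mu> * (t - s) / 2 + pi * C / \<mu> < e / 2 + e / 2"
        unfolding half by (rule add_strict_right_mono)
      then show ?thesis using le_less_trans[OF modulus[OF \<mu> that(1-3), of n]] by simp
    qed
    have "norm (T n x - T n y) < e" if "y \<in> {-pi..pi}" "norm (x - y) < e / \<mu>" for n y
      using mod[of x y n] mod[of y x n] x that by (cases "x \<le> y") (auto simp: norm_minus_commute)
    then show ?thesis using e \<mu> by (intro exI[of _ "e / \<mu>"]) auto
  qed
  obtain g and k :: "nat \<Rightarrow> nat" where k: "strict_mono k"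
    and lim: "\<And>e. 0 < e \<Longrightarrow> \<exists>N. \<forall>n x. n \<ge> N \<and> x \<in> {-pi..pi} \<longrightarrow> norm (T (k n) x - g x) < e"
    using Arzela_Ascoli[of "{-pi..pi}" T 1, OF compact_Icc _ equicont] norm_T by (metis order_refl)
  \<comment> \<open>The displacement becomes \<open>\<epsilon> * D\<close>-Lipschitz, with \<open>\<epsilon> * D < 1 / 3\<close> as required for the extension.\<close>
  define \<epsilon> where "\<epsilon> = 1 / (4 * D)"
  have \<epsilon>: "0 < \<epsilon>" "\<epsilon> * D = 1 / 4" using pos by (auto simp: \<epsilon>_def)
  obtain N where N: "\<And>n x. n \<ge> N \<Longrightarrow> x \<in> {-pi..pi} \<Longrightarrow> norm (T (k n) x - g x) < \<epsilon> / 2"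
    using lim[of "\<epsilon> / 2"] \<epsilon>(1) by auto
  define m n where "m = k N" and "n = k (Suc N)"
  have close: "norm (T n t - T m t) \<le> \<epsilon>" if t: "t \<in> {-pi..pi}" for t
    using norm_triangle_ineq4[of "T n t - g t" "T m t - g t"] N[of N, OF _ t] N[of "Suc N", OF _ t]
    by (simp add: m_def n_def)
  let ?f = "\<lambda>t. \<gamma> n t /\<^sub>R (c n / c m) - \<gamma> m t"
  have per: "circle_periodic (\<gamma> n)" and cont: "continuous_on UNIV (\<gamma> n)" for n
    using emb[of n] by (auto simp: circle_embedding_def)
  have f_bound: "norm (?f s - ?f t) \<le> (1 / 4) * norm (\<gamma> m s - \<gamma> m t)" if st: "-pi \<le> s" "s < t" "t < pi" for s t
  proof -
    have "norm (?f s - ?f t) \<le> c m * \<epsilon> * min (t - s) (2 * pi - (t - s))"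
      by (rule close_tangents_imp_close_curves[OF per per cont cont c c deriv deriv close]) (use st in auto)
    also have "\<dots> = \<epsilon> * (c m * min (t - s) (2 * pi - (t - s)))" by simp
    also have "\<dots> \<le> \<epsilon> * (D * norm (\<gamma> m s - \<gamma> m t))"
      using \<epsilon>(1) bilip[OF st] by (intro mult_left_mono) auto
    finally show ?thesis by (simp only: mult.assoc[symmetric] \<epsilon>(2))
  qed
  have "ambient_isotopic (\<gamma> m ` {-pi..<pi}) (\<gamma> n ` {-pi..<pi})"
  proof (rule ambient_isotopic_relatively_close)
    show "0 < c n / c m" using c by simp
    show "norm (?f s - ?f t) \<le> (1 / 4) * norm (\<gamma> m s - \<gamma> m t)" if "s \<in> {-pi..<pi}" "t \<in> {-pi..<pi}" for s t
    proof (rule linorder_cases[of s t])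
      assume "t < s"
      then show ?thesis
        using f_bound[of t s] that norm_minus_commute[of "?f s" "?f t"] norm_minus_commute[of "\<gamma> m s" "\<gamma> m t"]
        by simp
    qed (use f_bound[of s t] that in auto)
  qed auto
  then have "ambient_isotopic (range (\<gamma> m)) (range (\<gamma> n))"
    by (simp add: range_circle_periodic[OF per])
  moreover have "m \<noteq> n"
    using k by (auto simp: m_def n_def strict_mono_eq)
  ultimately show False using distinct by blast
qed

end
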